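(* Let $n,k$ be integers with $k\geq 2$ and $n\geq 50(k+1)^2$. Then \[ ar(n,F_{k+1})=\mathrm{ex}(n,F_k)+2. \]
   Context: All graphs are finite and simple. For $k\ge 1$, the friendship graph $F_k$ is the graph on $2k+1$ vertices consisting of $k$ triangles that share exactly one common vertex (and are otherwise vertex-disjoint). An edge-colored graph is rainbow if all its edges have distinct colors. For a positive integer $n$ and a family of graphs $\mathcal{G}$, the anti-Ramsey number $ar(n,\mathcal{G})$ is the minimum number $r$ such that every edge-coloring of the complete graph $K_n$ using exactly $r$ colors contains a rainbow copy of some graph in $\mathcal{G}$; $ar(n,G)$ means $ar(n,\{G\})$. The Turán number $\mathrm{ex}(n,G)$ is the maximum number of edges of an $n$-vertex graph containing no subgraph isomorphic to $G$. *)

theory Defs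
  imports "HOL-Library.Ramsey"
begin

text \<open>A graph is a pair of a vertex set and a set of edges, the edges being two-element sets
  of vertices; \<open>[V]\<^bsup>2\<^esup>\<close> is the library's set of two-element subsets of \<open>V\<close>.\<close>

type_synonym 'a graph = "'a set \<times> 'a set set"

abbreviation verts :: "'a graph \<Rightarrow> 'a set" where
  "verts G \<equiv> fst G"

abbreviation edges :: "'a graph \<Rightarrow> 'a set set" where
  "edges G \<equiv> snd G"

definition simple_graph :: "'a graph \<Rightarrow> bool" where
  "simple_graph G \<longleftrightarrow> finite (verts G) \<and> edges G \<subseteq> [verts G]\<^bsup>2\<^esup>"

definition subgraph :: "'a graph \<Rightarrow> 'a graph \<Rightarrow> bool" where
  "subgraph H G \<longleftrightarrow> simple_graph H \<and> simple_graph G \<and> verts H \<subseteq> verts G \<and> edges H \<subseteq> edges G"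

definition graph_iso :: "'a graph \<Rightarrow> 'b graph \<Rightarrow> bool" where
  "graph_iso G H \<longleftrightarrow>
     (\<exists>f. bij_betw f (verts G) (verts H) \<and> edges H = (\<lambda>e. f ` e) ` edges G)"

definition complete_graph :: "nat \<Rightarrow> nat graph" where
  "complete_graph n = ({..<n}, [{..<n}]\<^bsup>2\<^esup>)"

text \<open>The common vertex is \<open>0\<close>, and the \<open>i\<close>-th triangle is \<open>{0, 2 * i - 1, 2 * i}\<close>
  for \<open>1 \<le> i \<le> k\<close>.\<close>

definition friendship_graph :: "nat \<Rightarrow> nat graph" where
  "friendship_graph k =
     ({0..2 * k}, \<Union>i\<in>{1..k}. {{0, 2 * i - 1}, {0, 2 * i}, {2 * i - 1, 2 * i}})"

definition rainbow :: "('a set \<Rightarrow> 'c) \<Rightarrow> 'a graph \<Rightarrow> bool" where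
  "rainbow c H \<longleftrightarrow> inj_on c (edges H)"

text \<open>The number of colours ranges over the positive integers: for \<open>n \<ge> 2\<close> no edge-colouring of
  the complete graph uses exactly \<open>0\<close> colours, so \<open>r = 0\<close> would satisfy the condition vacuously.
  Values \<open>r > n choose 2\<close> do satisfy it vacuously, so the minimum always exists.\<close>

definition anti_ramsey :: "nat \<Rightarrow> 'a graph set \<Rightarrow> nat" where
  "anti_ramsey n \<G> = (LEAST r. r \<ge> 1 \<and>
     (\<forall>c :: nat set \<Rightarrow> nat. card (c ` edges (complete_graph n)) = r \<longrightarrow>
        (\<exists>G\<in>\<G>. \<exists>H. subgraph H (complete_graph n) \<and> graph_iso G H \<and> rainbow c H)))"

text \<open>Every finite graph is isomorphic to one with vertices in \<open>nat\<close>, so the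
  \<open>n\<close>-vertex graphs are taken there.\<close>

definition turan_number :: "nat \<Rightarrow> 'a graph \<Rightarrow> nat" where
  "turan_number n F = Max {card (edges G) | G :: nat graph.
     simple_graph G \<and> card (verts G) = n \<and> \<not> (\<exists>H. subgraph H G \<and> graph_iso F H)}"

end

theory Submission
  imports Defs
begin

text \<open>
  For the lower bound, colour an extremal \<open>F\<^sub>k\<close>-free graph injectively and all other edges with one
  extra colour: deleting one edge from \<open>F\<^bsub>k+1\<^esub>\<close> leaves a copy of \<open>F\<^sub>k\<close>.

  For the upper bound, write \<open>ex(n, F\<^sub>k) = n\<^sup>2 div 4 + X\<close>. Placing a graph of maximum degree and
  matching number less than \<open>k\<close> inside one half of a balanced complete bipartite graph keeps it
  \<open>F\<^sub>k\<close>-free, so \<open>X\<close> is at least the number of edges of every such graph, in particular at least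
  \<open>(k - 1)\<^sup>2\<close>. Suppose a colouring has \<open>ex(n, F\<^sub>k) + 2\<close> colours and no rainbow \<open>F\<^bsub>k+1\<^esub>\<close>. Delete vertices
  that lose few colours and choose one edge of each remaining colour: this gives a graph \<open>E\<close> on \<open>m\<close>
  vertices with minimum degree at least \<open>m div 2\<close>. Since neighbourhoods contain no matching of
  size \<open>k + 1\<close>, two large independent sets extend to a bipartition \<open>A\<close>, \<open>B\<close> with few missing cross
  edges and few inner edges, so most vertices are clean: joined to the whole other side and to
  nothing on their own side.

  Among \<open>k + 1\<close> disjoint pairs of clean vertices of \<open>B\<close> two have the same colour, say that of
  \<open>g0 \<in> E\<close>; likewise in \<open>A\<close>, with \<open>g1\<close>. In \<open>E1 = E - {g0, g1}\<close> no vertex is the centre of \<open>k\<close>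
  triangles, as a clean pair would give one more triangle. If the inner edges of one side contain a
  matching of size \<open>k - 1\<close>, then either both clean pairs extend it to a rainbow \<open>F\<^bsub>k+1\<^esub>\<close>, or
  \<open>g0 = g1\<close> and the inner edges of that side exceed \<open>X\<close>. Otherwise both matching numbers
  are at most \<open>k - 2\<close>, and a weighted bound on the number of edges in terms of the matching number
  shows that the inner edges outnumber the missing cross edges by less than \<open>(k - 1)\<^sup>2\<close>.
\<close>

section \<open>Matchings\<close>

definition matching :: "'a set set \<Rightarrow> 'a set set \<Rightarrow> bool" where
  "matching E M \<longleftrightarrow> M \<subseteq> E \<and> pairwise disjnt M"

definition matching_number :: "'a set set \<Rightarrow> nat" where
  "matching_number E = Max (card ` {M. matching E M})"

definition max_matching :: "'a set set \<Rightarrow> 'a set set \<Rightarrow> bool" where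
  "max_matching E M \<longleftrightarrow> matching E M \<and> card M = matching_number E"

definition degree :: "'a set set \<Rightarrow> 'a \<Rightarrow> nat" where
  "degree E x = card {e \<in> E. x \<in> e}"

lemma matching_empty [simp]: "matching E {}"
  by (simp add: matching_def)

lemma matching_mono: "matching E M \<Longrightarrow> E \<subseteq> F \<Longrightarrow> matching F M"
  by (auto simp: matching_def)

lemma matching_subset: "matching E M \<Longrightarrow> N \<subseteq> M \<Longrightarrow> matching E N"
  by (auto simp: matching_def intro: pairwise_subset)

lemma matching_unique: "matching E M \<Longrightarrow> e \<in> M \<Longrightarrow> f \<in> M \<Longrightarrow> x \<in> e \<Longrightarrow> x \<in> f \<Longrightarrow> e = f"
  by (auto simp: matching_def pairwise_def disjnt_def)

lemma matching_insert:
  "matching E M \<Longrightarrow> e \<in> E \<Longrightarrow> e \<inter> \<Union>M = {} \<Longrightarrow> matching E (insert e M)"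
  by (auto simp: matching_def pairwise_insert disjnt_def)

lemma card_exchange: "finite M \<Longrightarrow> e \<in> M \<Longrightarrow> f \<notin> M \<Longrightarrow> card (insert f (M - {e})) = card M"
  by (simp add: card_gt_0_iff) (metis Suc_pred card_gt_0_iff empty_iff)

lemma finite_matchings: "finite E \<Longrightarrow> finite {M. matching E M}"
  by (rule finite_subset[of _ "Pow E"]) (auto simp: matching_def)

lemma matching_number_ge: "finite E \<Longrightarrow> matching E M \<Longrightarrow> card M \<le> matching_number E"
  unfolding matching_number_def by (rule Max_ge) (auto simp: finite_matchings)

lemma max_matching_exists:
  assumes "finite E" shows "\<exists>M. max_matching E M"
proof -
  have "Max (card ` {M. matching E M}) \<in> card ` {M. matching E M}"
    by (rule Max_in) (use assms finite_matchings matching_empty in blast)+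
  then show ?thesis
    by (auto simp: max_matching_def matching_number_def)
qed

lemma finite_edges: "finite V \<Longrightarrow> E \<subseteq> [V]\<^bsup>2\<^esup> \<Longrightarrow> finite E"
  by (meson finite_imp_finite_nsets finite_subset)

lemma edge_other_end:
  assumes "e \<in> [V]\<^bsup>2\<^esup>" "x \<in> e"
  obtains y where "e = {x, y}" "x \<noteq> y" "y \<in> V"
  using assms by (auto elim!: nsets2_E simp: insert_commute)

lemma sum_degree:
  assumes "finite V" "E \<subseteq> [V]\<^bsup>2\<^esup>"
  shows "(\<Sum>x\<in>V. degree E x) = 2 * card E"
proof -
  have finE: "finite E" using finite_edges assms by blast
  have "(\<Sum>x\<in>V. degree E x) = (\<Sum>x\<in>V. \<Sum>e\<in>E. if x \<in> e then 1 else 0)"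
    unfolding degree_def using finE by (simp add: sum.If_cases Int_def)
  also have "\<dots> = (\<Sum>e\<in>E. \<Sum>x\<in>V. if x \<in> e then 1 else 0)"
    by (rule sum.swap)
  also have "\<dots> = (\<Sum>e\<in>E. 2)"
  proof (rule sum.cong)
    fix e assume "e \<in> E"
    then have "V \<inter> {x. x \<in> e} = e" "card e = 2"
      using assms by (auto simp: nsets_def)
    then show "(\<Sum>x\<in>V. if x \<in> e then 1 else 0) = (2::nat)"
      using assms by (simp add: sum.If_cases)
  qed auto
  finally show ?thesis by simp
qed

text \<open>The matching \<open>M'\<close> is \<open>M\<close> switched along the alternating path of \<open>M\<close> and \<open>N\<close>
  that starts at \<open>v\<close>.\<close>

lemma max_matching_exchange:
  assumes "finite V" "E \<subseteq> [V]\<^bsup>2\<^esup>"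
  shows "max_matching E M \<Longrightarrow> max_matching E N \<Longrightarrow> v \<in> \<Union>M \<Longrightarrow> v \<notin> \<Union>N \<Longrightarrow>
    \<exists>M' z. max_matching E M' \<and> M \<inter> N \<subseteq> M' \<and> v \<notin> \<Union>M' \<and> \<Union>M' \<subseteq> insert z (\<Union>M)"
proof (induction "card (M - N)" arbitrary: N v rule: less_induct)
  case less
  have finE: "finite E" using finite_edges assms by blast
  have M: "matching E M" "card M = matching_number E" "finite M" "M \<subseteq> E"
    and N: "matching E N" "card N = matching_number E" "finite N" "N \<subseteq> E"
    using less.prems finE by (auto simp: max_matching_def matching_def intro: finite_subset)
  obtain e where e: "e \<in> M" "v \<in> e" using less.prems by blast
  then obtain v1 where v1: "e = {v, v1}" "v \<noteq> v1"
    using edge_other_end[of e V v] M assms by blast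
  have eN: "e \<notin> N" using e less.prems by blast
  have "v1 \<in> \<Union>N"
  proof (rule ccontr)
    assume "v1 \<notin> \<Union>N"
    then have "matching E (insert e N)"
      using matching_insert[of E N e] N M e less.prems(4) v1 by auto
    then have "card (insert e N) \<le> matching_number E"
      using finE matching_number_ge by blast
    then show False using N eN by simp
  qed
  then obtain f where f: "f \<in> N" "v1 \<in> f" by blast
  then obtain v2 where v2: "f = {v1, v2}" "v1 \<noteq> v2"
    using edge_other_end[of f V v1] N assms by blast
  have ef: "e \<noteq> f" using f eN by blast
  have "v2 \<noteq> v" using v2 less.prems f by blast
  have fM: "f \<notin> M"
    using matching_unique[OF M(1) e(1), of f v1] v1 f ef by auto
  have unionN: "v2 \<notin> \<Union>(N - {f})" "v1 \<notin> \<Union>(N - {f})"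
    using matching_unique[OF N(1) f(1)] v2 by auto
  have unionM: "v \<notin> \<Union>(M - {e})" "v1 \<notin> \<Union>(M - {e})"
    using matching_unique[OF M(1) e(1)] v1 by auto
  show ?case
  \<comment> \<open>If \<open>M\<close> misses \<open>v2\<close>, the alternating path ends there
    and exchanging \<open>e\<close> for \<open>f\<close> suffices, with \<open>z = v2\<close>.
    Otherwise \<open>N\<close> is switched on its first two edges and the rest of the path is
    handled from \<open>v2\<close>.\<close>
  proof (cases "v2 \<in> \<Union>M")
    case False
    let ?M = "insert f (M - {e})"
    have "matching E ?M"
      using matching_insert[OF matching_subset[OF M(1), of "M - {e}"], of f] f N False unionM v2
      by auto
    moreover have "card ?M = card M"
      using fM e M by (intro card_exchange) auto
    moreover have "\<Union>?M \<subseteq> insert v2 (\<Union>M)"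
      using v2 v1 e by auto
    moreover have "M \<inter> N \<subseteq> ?M" "v \<notin> \<Union>?M" using eN unionM v2 v1 \<open>v2 \<noteq> v\<close> by auto
    moreover have "max_matching E ?M"
      unfolding max_matching_def by (intro conjI calculation(1) calculation(2)[THEN trans, OF M(2)])
    ultimately have "max_matching E ?M \<and> M \<inter> N \<subseteq> ?M \<and> v \<notin> \<Union>?M \<and> \<Union>?M \<subseteq> insert v2 (\<Union>M)"
      by (intro conjI)
    then show ?thesis by - (rule exI[of _ ?M], rule exI[of _ v2])
  next
    case True
    let ?N = "insert e (N - {f})"
    have mN: "matching E ?N"
      using matching_insert[OF matching_subset[OF N(1), of "N - {f}"], of e] e M unionN v1 less.prems(4)
      by auto
    have cN: "card ?N = card N"
      using eN f N by (intro card_exchange) auto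
    have "v2 \<notin> \<Union>?N"
      using unionN v1 \<open>v2 \<noteq> v\<close> v2 by auto
    \<comment> \<open>Adding \<open>e\<close> to \<open>N\<close> shrinks the difference, and giving
      up \<open>f\<close> does not enlarge it because \<open>f \<notin> M\<close>.\<close>
    moreover have "card (M - ?N) < card (M - N)"
      using e eN fM M by (intro psubset_card_mono) auto
    ultimately obtain M'' z where M'': "max_matching E M''" "M \<inter> ?N \<subseteq> M''" "v2 \<notin> \<Union>M''" "\<Union>M'' \<subseteq> insert z (\<Union>M)"
      using less.hyps[of ?N v2] less.prems(1) True mN cN N
      by (auto simp: max_matching_def)
    have mM'': "matching E M''" "card M'' = matching_number E" "finite M''"
      using M''(1) finE by (auto simp: max_matching_def matching_def intro: finite_subset)
    \<comment> \<open>Now \<open>e\<close> lies in both matchings, so the conclusion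
      \<open>M \<inter> N \<subseteq> M'\<close> of the induction keeps it in \<open>M''\<close>.
      Exchanging it for \<open>f\<close> afterwards frees \<open>v\<close>.\<close>
    have e'': "e \<in> M''" using M''(2) e by blast
    have unionM'': "v \<notin> \<Union>(M'' - {e})" "v1 \<notin> \<Union>(M'' - {e})" "v2 \<notin> \<Union>M''"
      using matching_unique[OF mM''(1) e''] v1 M''(3,4) by auto
    let ?M = "insert f (M'' - {e})"
    have "f \<notin> M''" using unionM'' v2 by auto
    have "matching E ?M"
      using matching_insert[OF matching_subset[OF mM''(1), of "M'' - {e}"], of f] f N unionM'' v2
      by auto
    moreover have "card ?M = card M''"
      using \<open>f \<notin> M''\<close> e'' mM'' by (intro card_exchange) auto
    moreover have "M \<inter> N \<subseteq> ?M"
      using M''(2) eN fM by auto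
    moreover have "v \<notin> \<Union>?M" using unionM''(1) v2 v1(2) \<open>v2 \<noteq> v\<close> by auto
    moreover have "\<Union>?M \<subseteq> insert z (\<Union>M)"
    proof -
      have "f \<subseteq> \<Union>M" using v2(1) v1(1) e(1) True by auto
      then show ?thesis using M''(4) by blast
    qed
    moreover have "max_matching E ?M"
      unfolding max_matching_def by (intro conjI calculation(1) calculation(2)[THEN trans, OF mM''(2)])
    ultimately have "max_matching E ?M \<and> M \<inter> N \<subseteq> ?M \<and> v \<notin> \<Union>?M \<and> \<Union>?M \<subseteq> insert z (\<Union>M)"
      by (intro conjI)
    then show ?thesis by - (rule exI[of _ ?M], rule exI[of _ z])
  qed
qed

text \<open>If \<open>M\<close> avoided \<open>u\<close> and \<open>w\<close>, it would cover
  \<open>v\<close>. Switching \<open>M\<close> so that \<open>v\<close> is released covers at most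
  one new vertex \<open>z\<close>, yet the new matching would have to cover both \<open>u\<close>
  and \<open>w\<close>.\<close>

lemma max_matching_avoids_trans:
  assumes V: "finite V" "E \<subseteq> [V]\<^bsup>2\<^esup>"
    and avoid: "\<exists>N. max_matching E N \<and> v \<notin> \<Union>N"
    and uv: "\<And>M. max_matching E M \<Longrightarrow> u \<in> \<Union>M \<or> v \<in> \<Union>M"
    and vw: "\<And>M. max_matching E M \<Longrightarrow> v \<in> \<Union>M \<or> w \<in> \<Union>M"
    and M: "max_matching E M" and "u \<noteq> w"
  shows "u \<in> \<Union>M \<or> w \<in> \<Union>M"
proof (rule ccontr)
  assume uw: "\<not> (u \<in> \<Union>M \<or> w \<in> \<Union>M)"
  then have "v \<in> \<Union>M" using uv[OF M] by blast
  with avoid max_matching_exchange[OF V M] obtain M' z where "max_matching E M'" "v \<notin> \<Union>M'" "\<Union>M' \<subseteq> insert z (\<Union>M)"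
    by metis
  with uv[of M'] vw[of M'] uw \<open>u \<noteq> w\<close> show False
    by (metis insertE subset_iff)
qed

text \<open>Gallai's lemma: the classes of the relation \<open>no maximum matching avoids both\<close>.\<close>

lemma gallai_classes:
  assumes V: "finite V" "E \<subseteq> [V]\<^bsup>2\<^esup>"
    and avoid: "\<And>v. v \<in> V \<Longrightarrow> \<exists>N. max_matching E N \<and> v \<notin> \<Union>N"
  obtains r where "equiv V r"
    "\<And>e. e \<in> E \<Longrightarrow> \<exists>C \<in> V // r. e \<subseteq> C"
    "\<And>M C. max_matching E M \<Longrightarrow> C \<in> V // r \<Longrightarrow> card (C - \<Union>M) \<le> 1"
proof -
  \<comment> \<open>Reflexivity is put in by hand: every vertex is avoided by some maximum matching,
    so the second condition never relates a vertex to itself.\<close>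
  define r where "r = {(u, w). u \<in> V \<and> w \<in> V \<and>
    (u = w \<or> (\<forall>M. max_matching E M \<longrightarrow> u \<in> \<Union>M \<or> w \<in> \<Union>M))}"
  have finE: "finite E" using finite_edges V by blast
  have eq: "equiv V r"
  proof (rule equivI)
    show "r \<subseteq> V \<times> V" by (auto simp: r_def)
    show "refl_on V r" by (auto simp: r_def refl_on_def)
    show "sym r" by (auto simp: r_def sym_def)
    show "trans r"
    proof (rule transI)
      fix u v w assume *: "(u, v) \<in> r" "(v, w) \<in> r"
      show "(u, w) \<in> r"
      proof (cases "u = v \<or> v = w \<or> u = w")
        case True
        then show ?thesis using * by (auto simp: r_def)
      next
        case False
        then have "u \<in> \<Union>M \<or> w \<in> \<Union>M" if "max_matching E M" for M
          using max_matching_avoids_trans[OF V avoid _ _ that, of v u w] *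
          by (auto simp: r_def)
        then show ?thesis using * by (auto simp: r_def)
      qed
    qed
  qed
  have edge: "\<exists>C \<in> V // r. e \<subseteq> C" if "e \<in> E" for e
  proof -
    obtain u w where e: "e = {u, w}" "u \<in> V" "w \<in> V" "u \<noteq> w"
      using V \<open>e \<in> E\<close> by (blast elim: nsets2_E)
    have "u \<in> \<Union>M \<or> w \<in> \<Union>M" if M: "max_matching E M" for M
    proof (rule ccontr)
      assume *: "\<not> ?thesis"
      then have "matching E (insert e M)"
        using M \<open>e \<in> E\<close> e by (intro matching_insert) (auto simp: max_matching_def)
      moreover have "e \<notin> M" using * e by blast
      moreover have "finite M"
        using M finE by (auto simp: max_matching_def matching_def intro: finite_subset)
      ultimately show False
        using M matching_number_ge[OF finE] by (fastforce simp: max_matching_def)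
    qed
    then have "(u, w) \<in> r" using e by (auto simp: r_def)
    then have "e \<subseteq> r `` {u}" using e by (auto simp: r_def)
    then show ?thesis using e by (meson quotientI)
  qed
  have "card (C - \<Union>M) \<le> 1" if M: "max_matching E M" and C: "C \<in> V // r" for M C
  proof -
    have "u = w" if "u \<in> C - \<Union>M" "w \<in> C - \<Union>M" for u w
    proof -
      have "(u, w) \<in> r"
        using quotient_eq_iff[OF eq C C, of u w] that by blast
      then show ?thesis using M that by (auto simp: r_def)
    qed
    moreover have "finite (C - \<Union>M)"
      using C V eq by (meson finite_Diff finite_equiv_class finite_subset in_quotient_imp_subset)
    ultimately show ?thesis
      by (simp add: card_le_Suc0_iff_eq)
  qed
  with eq edge that show thesis by blast
qed

section \<open>Degree bounds and a weighted edge count\<close>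

lemma degree_le_card:
  assumes "finite V" "E \<subseteq> [V]\<^bsup>2\<^esup>"
  shows "degree E x \<le> card V - 1"
proof (cases "x \<in> V")
  case True
  have "{e \<in> E. x \<in> e} \<subseteq> (\<lambda>y. {x, y}) ` (V - {x})"
  proof
    fix e assume "e \<in> {e \<in> E. x \<in> e}"
    then obtain y where "e = {x, y}" "x \<noteq> y" "y \<in> V"
      using assms by (auto elim: edge_other_end)
    then show "e \<in> (\<lambda>y. {x, y}) ` (V - {x})" by auto
  qed
  then have "degree E x \<le> card (V - {x})"
    unfolding degree_def using assms by (meson finite_Diff surj_card_le)
  then show ?thesis using assms True by simp
next
  case False
  then have "{e \<in> E. x \<in> e} = {}" using assms by (auto simp: nsets_def)
  then show ?thesis unfolding degree_def by (metis card.empty zero_le)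
qed

lemma degree_mono: "finite E \<Longrightarrow> F \<subseteq> E \<Longrightarrow> degree F x \<le> degree E x"
  unfolding degree_def by (rule card_mono) auto

lemma card_Union_edges_le:
  assumes "M \<subseteq> [V]\<^bsup>2\<^esup>"
  shows "card (\<Union>M) \<le> 2 * card M"
proof -
  have "card (\<Union>M) \<le> (\<Sum>e\<in>M. card e)" by (rule card_Union_le_sum_card)
  also have "\<dots> = (\<Sum>e\<in>M. 2)"
    using assms by (intro sum.cong) (auto simp: nsets_def)
  finally show ?thesis by simp
qed

text \<open>In the application \<open>\<mu> x\<close> is the number of cross edges missing at \<open>x\<close>. A vertex covered by all
  maximum matchings is deleted, at cost \<open>p + D\<close>; if there is none, each Gallai class \<open>C\<close> with \<open>n\<close>
  matching edges has at most \<open>2 * n + 1\<close> vertices.\<close>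

lemma weighted_edge_bound:
  fixes \<mu> :: "'a \<Rightarrow> nat"
  assumes K: "p + D \<le> K" "2 * D \<le> K" "\<And>n. (2 * n + 1) * min D (2 * n) \<le> n * K"
  shows "finite V \<Longrightarrow> E \<subseteq> [V]\<^bsup>2\<^esup> \<Longrightarrow> (\<And>x. x \<in> V \<Longrightarrow> degree E x \<le> p) \<Longrightarrow>
    (\<And>x. x \<in> V \<Longrightarrow> degree E x \<le> D + \<mu> x) \<Longrightarrow>
    2 * card E \<le> (\<Sum>x\<in>V. \<mu> x) + K * matching_number E"
proof (induction "card V" arbitrary: V E rule: less_induct)
  case less
  note V = less.prems(1,2) and dp = less.prems(3) and dD = less.prems(4)
  have finE: "finite E" using finite_edges V by blast
  show ?case
  proof (cases "\<exists>v\<in>V. \<forall>N. max_matching E N \<longrightarrow> v \<in> \<Union>N")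
    case True
    then obtain v where v: "v \<in> V" "\<And>N. max_matching E N \<Longrightarrow> v \<in> \<Union>N" by blast
    let ?E = "{e \<in> E. v \<notin> e}"
    have "?E \<subseteq> E" by blast
    have "degree ?E x \<le> degree E x" for x
      using degree_mono[OF finE \<open>?E \<subseteq> E\<close>] .
    then have "degree ?E x \<le> p" "degree ?E x \<le> D + \<mu> x" if "x \<in> V - {v}" for x
      using dp[of x] dD[of x] that by (meson DiffD1 order_trans)+
    moreover have "card (V - {v}) < card V" using V v by (intro psubset_card_mono) auto
    moreover have "?E \<subseteq> [V - {v}]\<^bsup>2\<^esup>" using V by (auto simp: nsets_def)
    ultimately have "2 * card ?E \<le> (\<Sum>x\<in>V - {v}. \<mu> x) + K * matching_number ?E"
      using V by (intro less.hyps) auto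
    \<comment> \<open>A maximum matching of \<open>?E\<close> misses \<open>v\<close>, hence is not
      maximum in \<open>E\<close>.\<close>
    moreover have "matching_number ?E < matching_number E"
    proof -
      obtain M where M: "max_matching ?E M" using max_matching_exists[of ?E] finE by auto
      then have mM: "matching E M" "M \<subseteq> ?E" "card M = matching_number ?E"
        by (auto simp: max_matching_def matching_def)
      then have "v \<notin> \<Union>M" by blast
      then have "\<not> max_matching E M" using v by blast
      then show ?thesis
        using mM matching_number_ge[OF finE mM(1)] by (auto simp: max_matching_def)
    qed
    then have "K * matching_number ?E + K \<le> K * matching_number E"
      by (metis Suc_leI mult_Suc_right mult_le_mono2 add.commute)
    moreover have "card E = card ?E + degree E v"
    proof -
      have "E = ?E \<union> {e \<in> E. v \<in> e}" by blast
      then show ?thesis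
        unfolding degree_def using finE by (subst card_Un_disjoint[symmetric]) auto
    qed
    \<comment> \<open>Adding the bounds \<open>p\<close> and \<open>D + \<mu> v\<close> on the same
      degree pays for the doubled number of lost edges.\<close>
    moreover have "2 * degree E v \<le> K + \<mu> v"
      using dp[OF v(1)] dD[OF v(1)] K(1) by linarith
    moreover have "(\<Sum>x\<in>V. \<mu> x) = \<mu> v + (\<Sum>x\<in>V - {v}. \<mu> x)"
      using V v by (simp add: sum.remove)
    ultimately show ?thesis by linarith
  next
    case False
    then obtain r where r: "equiv V r" "\<And>e. e \<in> E \<Longrightarrow> \<exists>C \<in> V // r. e \<subseteq> C"
      "\<And>M C. max_matching E M \<Longrightarrow> C \<in> V // r \<Longrightarrow> card (C - \<Union>M) \<le> 1"
      using gallai_classes[OF V] by metis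
    obtain M where M: "max_matching E M" using max_matching_exists[OF finE] ..
    then have mM: "matching E M" "card M = matching_number E" "M \<subseteq> E" "finite M"
      using finE by (auto simp: max_matching_def matching_def intro: finite_subset)
    define EC where "EC C = {e \<in> E. e \<subseteq> C}" for C
    define MC where "MC C = {e \<in> M. e \<subseteq> C}" for C
    have finQ: "finite (V // r)"
      using V r(1) by (simp add: finite_quotient equiv_type)
    have sub: "C \<subseteq> V" "finite C" if "C \<in> V // r" for C
      using in_quotient_imp_subset[OF r(1) that] V finite_subset by blast+
    have disj: "C = C'" if "C \<in> V // r" "C' \<in> V // r" "x \<in> C" "x \<in> C'" for C C' x
      using quotient_disj[OF r(1) that(1,2)] that by blast
    have ne: "e \<noteq> {}" if "e \<in> E" for e using V that by (auto simp: nsets_def)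
    have class_bound: "2 * card (EC C) \<le> (\<Sum>x\<in>C. \<mu> x) + K * card (MC C)" if C: "C \<in> V // r" for C
    proof -
      let ?n = "card (MC C)"
      have ECC: "EC C \<subseteq> [C]\<^bsup>2\<^esup>" using V by (auto simp: EC_def nsets_def)
      \<comment> \<open>Edges of \<open>M\<close> do not leave their classes, so a covered vertex of
        \<open>C\<close> is covered by an edge of \<open>MC C\<close>.\<close>
      have "C \<subseteq> (C - \<Union>M) \<union> \<Union>(MC C)"
      proof
        fix x assume x: "x \<in> C"
        show "x \<in> (C - \<Union>M) \<union> \<Union>(MC C)"
        proof (cases "x \<in> \<Union>M")
          case True
          then obtain e where e: "e \<in> M" "x \<in> e" by blast
          then obtain C' where "C' \<in> V // r" "e \<subseteq> C'" using r(2) mM by blast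
          with disj[of C C' x] C x e show ?thesis by (auto simp: MC_def)
        qed (use x in auto)
      qed
      then have "card C \<le> card ((C - \<Union>M) \<union> \<Union>(MC C))"
        using sub(2)[OF C] by (intro card_mono) (auto simp: MC_def intro: finite_subset[of _ C])
      also have "\<dots> \<le> card (C - \<Union>M) + card (\<Union>(MC C))" by (rule card_Un_le)
      also have "\<dots> \<le> 1 + 2 * ?n"
        using r(3)[OF M C] card_Union_edges_le[of "MC C" V] mM V by (intro add_mono) (auto simp: MC_def)
      finally have cC: "card C \<le> 2 * ?n + 1" by simp
      have d1: "degree (EC C) x \<le> D + \<mu> x" if "x \<in> C" for x
        using degree_mono[OF finE, of "EC C" x] dD[of x] that sub[OF C] by (force simp: EC_def)
      have d2: "degree (EC C) x \<le> card C - 1" for x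
        using degree_le_card[OF sub(2)[OF C] ECC] .
      have "2 * card (EC C) = (\<Sum>x\<in>C. degree (EC C) x)"
        using sum_degree[OF sub(2)[OF C] ECC] by simp
      also have "\<dots> \<le> (\<Sum>x\<in>C. min D (card C - 1) + \<mu> x)"
      proof (rule sum_mono)
        fix x assume "x \<in> C"
        then show "degree (EC C) x \<le> min D (card C - 1) + \<mu> x"
          using d1[of x] d2[of x] by linarith
      qed
      also have "\<dots> = (\<Sum>x\<in>C. \<mu> x) + card C * min D (card C - 1)"
        by (simp add: sum.distrib)
      also have "card C * min D (card C - 1) \<le> ?n * K"
      \<comment> \<open>With at most \<open>2 * ?n\<close> vertices, the bound \<open>D\<close> per
        vertex and \<open>2 * D \<le> K\<close> suffice. The third condition on \<open>K\<close>
        handles the remaining size \<open>2 * ?n + 1\<close>.\<close>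
      proof (cases "card C \<le> 2 * ?n")
        case True
        then have "card C * min D (card C - 1) \<le> (2 * ?n) * D" by (intro mult_mono) auto
        also have "\<dots> = ?n * (2 * D)" by simp
        also have "\<dots> \<le> ?n * K" using K(2) by (intro mult_mono) auto
        finally show ?thesis .
      next
        case False
        then have "card C = 2 * ?n + 1" using cC by simp
        then show ?thesis using K(3)[of ?n] by simp
      qed
      finally show ?thesis by (simp add: mult.commute)
    qed
    have "card E \<le> card (\<Union>C\<in>V // r. EC C)"
      using r(2) finE by (intro card_mono) (auto simp: EC_def finQ)
    also have "\<dots> \<le> (\<Sum>C\<in>V // r. card (EC C))"
      by (rule card_UN_le[OF finQ])
    finally have "2 * card E \<le> (\<Sum>C\<in>V // r. 2 * card (EC C))"
      by (simp add: sum_distrib_left[symmetric])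
    also have "\<dots> \<le> (\<Sum>C\<in>V // r. (\<Sum>x\<in>C. \<mu> x) + K * card (MC C))"
      by (rule sum_mono) (rule class_bound)
    also have "\<dots> = (\<Sum>C\<in>V // r. \<Sum>x\<in>C. \<mu> x) + K * (\<Sum>C\<in>V // r. card (MC C))"
      by (simp add: sum.distrib sum_distrib_left)
    also have "(\<Sum>C\<in>V // r. \<Sum>x\<in>C. \<mu> x) = (\<Sum>x\<in>V. \<mu> x)"
    proof -
      have "sum \<mu> (\<Union>(V // r)) = (sum \<circ> sum) \<mu> (V // r)"
        using sub disj by (intro sum.Union_disjoint) blast+
      then show ?thesis by (simp add: Union_quotient[OF r(1)])
    qed
    also have "(\<Sum>C\<in>V // r. card (MC C)) = card (\<Union>C\<in>V // r. MC C)"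
    proof (rule card_UN_disjoint[symmetric])
      show "\<forall>C\<in>V // r. \<forall>C'\<in>V // r. C \<noteq> C' \<longrightarrow> MC C \<inter> MC C' = {}"
      proof (intro ballI impI, rule ccontr)
        fix C C' assume *: "C \<in> V // r" "C' \<in> V // r" "C \<noteq> C'" "MC C \<inter> MC C' \<noteq> {}"
        then obtain e where e: "e \<in> M" "e \<subseteq> C" "e \<subseteq> C'" by (auto simp: MC_def)
        then obtain x where "x \<in> e" using ne mM by blast
        then show False using disj[of C C' x] * e by blast
      qed
    qed (auto simp: finQ MC_def mM)
    also have "\<dots> \<le> card M" using mM by (intro card_mono) (auto simp: MC_def)
    finally show ?thesis using mM by simp
  qed
qed

section \<open>Fans and friendship graphs\<close>

text \<open>A copy of a friendship graph with centre \<open>x\<close> is encoded by the set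
  \<open>M\<close> of its edges opposite to \<open>x\<close>: a matching away from \<open>x\<close>
  with one edge per triangle. The spokes are added by \<open>fan_edges\<close>.\<close>

definition fan :: "'a \<Rightarrow> 'a set set \<Rightarrow> bool" where
  "fan x M \<longleftrightarrow> finite M \<and> (\<forall>e\<in>M. card e = 2) \<and> pairwise disjnt M \<and> x \<notin> \<Union>M"

definition fan_edges :: "'a \<Rightarrow> 'a set set \<Rightarrow> 'a set set" where
  "fan_edges x M = M \<union> (\<lambda>u. {x, u}) ` \<Union>M"

lemma fan_subset: "fan x M \<Longrightarrow> N \<subseteq> M \<Longrightarrow> fan x N"
  by (auto simp: fan_def intro: finite_subset pairwise_subset)

lemma fan_edges_mono: "N \<subseteq> M \<Longrightarrow> fan_edges x N \<subseteq> fan_edges x M"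
  by (auto simp: fan_edges_def)

lemma fan_insert:
  "fan x M \<Longrightarrow> u \<noteq> v \<Longrightarrow> u \<noteq> x \<Longrightarrow> v \<noteq> x \<Longrightarrow> u \<notin> \<Union>M \<Longrightarrow> v \<notin> \<Union>M \<Longrightarrow> fan x (insert {u, v} M)"
  by (auto simp: fan_def pairwise_insert disjnt_def)

lemma fan_edges_insert: "fan_edges x (insert {u, v} M) = {{u, v}, {x, u}, {x, v}} \<union> fan_edges x M"
  by (auto simp: fan_edges_def)

lemma fan_image:
  assumes "fan x M" "inj_on f (insert x (\<Union>M))"
  shows "fan (f x) ((`) f ` M)" "card ((`) f ` M) = card M"
    "fan_edges (f x) ((`) f ` M) = (`) f ` fan_edges x M"
proof -
  have inj: "inj_on f (\<Union>M)" using assms by (auto intro: inj_on_subset)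
  have dis: "f ` e \<inter> f ` e' = f ` (e \<inter> e')" if "e \<in> M" "e' \<in> M" for e e'
    using inj that by (intro inj_on_image_Int[symmetric]) auto
  have "card (f ` e) = 2" if "e \<in> M" for e
    using assms that inj by (subst card_image) (auto simp: fan_def intro: inj_on_subset)
  moreover have "pairwise disjnt ((`) f ` M)"
  proof (rule pairwiseI)
    fix a b assume "a \<in> (`) f ` M" "b \<in> (`) f ` M" "a \<noteq> b"
    then obtain e e' where "a = f ` e" "b = f ` e'" "e \<in> M" "e' \<in> M" "e \<noteq> e'" by blast
    moreover from this have "e \<inter> e' = {}" using assms by (auto simp: fan_def pairwise_def disjnt_def)
    ultimately show "disjnt a b" using dis by (simp add: disjnt_def)
  qed
  moreover have "f x \<notin> \<Union>((`) f ` M)"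
    using assms by (auto simp: fan_def inj_on_def)
  ultimately show "fan (f x) ((`) f ` M)"
    using assms by (auto simp: fan_def)
  show "card ((`) f ` M) = card M"
    by (rule card_image) (use inj inj_on_image in blast)
  show "fan_edges (f x) ((`) f ` M) = (`) f ` fan_edges x M"
    by (auto simp: fan_edges_def image_Un image_image)
qed

lemma atLeastAtMost_double_eq: "{0..2 * K} = insert 0 (\<Union>i\<in>{1..K}. {2 * i - 1, 2 * i :: nat})"
proof (intro equalityI subsetI)
  fix j assume j: "j \<in> {0..2 * K}"
  show "j \<in> insert 0 (\<Union>i\<in>{1..K}. {2 * i - 1, 2 * i})"
  proof (cases "j = 0")
    case False
    let ?i = "(j + 1) div 2"
    have "j \<le> 2 * K" using j by simp
    with False have "1 \<le> ?i" "?i \<le> K" "j = 2 * ?i - 1 \<or> j = 2 * ?i" by presburger+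
    then show ?thesis by auto
  qed simp
qed auto

lemma friendship_graph_image:
  assumes inj: "inj_on f {0..2 * K}"
  defines "M \<equiv> (\<lambda>i. {f (2 * i - 1), f (2 * i)}) ` {1..K}"
  shows "fan (f 0) M" "card M = K" "f ` {0..2 * K} = insert (f 0) (\<Union>M)"
    "(`) f ` edges (friendship_graph K) = fan_edges (f 0) M"
proof -
  have eq: "f i = f j \<longleftrightarrow> i = j" if "i \<le> 2 * K" "j \<le> 2 * K" for i j
    using inj that by (auto simp: inj_on_def)
  have inter: "{f (2 * i - 1), f (2 * i)} \<inter> {f (2 * j - 1), f (2 * j)} = {}"
    if "i \<in> {1..K}" "j \<in> {1..K}" "i \<noteq> j" for i j
  proof -
    have "2 * i - 1 \<noteq> 2 * j - 1" "2 * i - 1 \<noteq> 2 * j" "2 * i \<noteq> 2 * j - 1" "2 * i \<noteq> 2 * j"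
    proof -
      have "1 \<le> i" "1 \<le> j" using that by auto
      then show "2 * i - 1 \<noteq> 2 * j - 1" "2 * i - 1 \<noteq> 2 * j" "2 * i \<noteq> 2 * j - 1" "2 * i \<noteq> 2 * j"
        using \<open>i \<noteq> j\<close> by presburger+
    qed
    then show ?thesis using that by (auto simp: eq)
  qed
  have "inj_on (\<lambda>i. {f (2 * i - 1), f (2 * i)}) {1..K}"
    using inter by (intro inj_onI) (metis inf.idem insert_not_empty)
  then show "card M = K" unfolding M_def by (simp add: card_image)
  have "card {f (2 * i - 1), f (2 * i)} = 2" if "i \<in> {1..K}" for i
  proof -
    have "2 * i - 1 \<noteq> 2 * i" using that by auto
    then show ?thesis using that by (auto simp: eq)
  qed
  moreover have "f 0 \<notin> \<Union>M"
    unfolding M_def by (auto simp: eq)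
  moreover have "pairwise disjnt M"
    using inter unfolding M_def pairwise_def disjnt_def by blast
  ultimately show "fan (f 0) M"
    by (auto simp: fan_def M_def)
  show "f ` {0..2 * K} = insert (f 0) (\<Union>M)"
    unfolding M_def by (subst atLeastAtMost_double_eq) (simp add: image_UN)
  show "(`) f ` edges (friendship_graph K) = fan_edges (f 0) M"
    unfolding friendship_graph_def fan_edges_def M_def
    by (auto simp: image_UN image_Un image_image)
qed

text \<open>This lets copies of friendship graphs be treated as fans. A fan is relabelled by
  enumerating its matching and sending \<open>2 * i - 1\<close> and \<open>2 * i\<close> to the ends
  of the \<open>i\<close>-th edge.\<close>

lemma graph_iso_friendship_graph_iff:
  "graph_iso (friendship_graph K) H \<longleftrightarrow>
     (\<exists>x M. fan x M \<and> card M = K \<and> H = (insert x (\<Union>M), fan_edges x M))"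
proof
  assume "graph_iso (friendship_graph K) H"
  then obtain f where f: "bij_betw f {0..2 * K} (verts H)"
      "edges H = (`) f ` edges (friendship_graph K)"
    by (auto simp: graph_iso_def friendship_graph_def)
  then have "inj_on f {0..2 * K}" "f ` {0..2 * K} = verts H"
    by (auto simp: bij_betw_def)
  then show "\<exists>x M. fan x M \<and> card M = K \<and> H = (insert x (\<Union>M), fan_edges x M)"
    using friendship_graph_image[of f K] f(2) by (metis prod.collapse)
next
  assume "\<exists>x M. fan x M \<and> card M = K \<and> H = (insert x (\<Union>M), fan_edges x M)"
  then obtain x M where M: "fan x M" "card M = K" "H = (insert x (\<Union>M), fan_edges x M)"
    by blast
  then obtain h where h: "bij_betw h {1..K} M"
    using ex_bij_betw_nat_finite_1[of M] by (auto simp: fan_def)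
  have "\<exists>u w. h i = {u, w} \<and> u \<noteq> w" if "i \<in> {1..K}" for i
  proof -
    have "h i \<in> M" using h that by (rule bij_betwE[THEN bspec])
    then have "card (h i) = 2" using M by (simp add: fan_def)
    then show ?thesis by (auto simp: card_2_iff)
  qed
  then obtain u w where uw: "\<And>i. i \<in> {1..K} \<Longrightarrow> h i = {u i, w i} \<and> u i \<noteq> w i"
    by metis
  define f where "f j = (if j = 0 then x else if odd j then u ((j + 1) div 2) else w (j div 2))" for j
  have fi: "f (2 * i - 1) = u i" "f (2 * i) = w i" if "i \<in> {1..K}" for i
    using that by (auto simp: f_def)
  have M': "M = (\<lambda>i. {f (2 * i - 1), f (2 * i)}) ` {1..K}"
  proof -
    have "M = h ` {1..K}" using h by (simp add: bij_betw_def)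
    also have "\<dots> = (\<lambda>i. {f (2 * i - 1), f (2 * i)}) ` {1..K}"
      using uw fi by (intro image_cong) auto
    finally show ?thesis .
  qed
  have f0: "f 0 = x" by (simp add: f_def)
  have inj: "inj_on f {0..2 * K}"
  \<comment> \<open>Injectivity by counting: the image consists of \<open>x\<close> and the
    \<open>2 * K\<close> vertices of the matching.\<close>
  proof (rule eq_card_imp_inj_on)
    have "f ` {0..2 * K} = insert x (\<Union>M)"
      unfolding M' by (subst atLeastAtMost_double_eq) (simp add: image_UN f0)
    moreover have "card (\<Union>M) = 2 * K"
    proof -
      have "card (\<Union>M) = (\<Sum>e\<in>M. card e)"
        using M by (intro card_Union_disjoint) (auto simp: fan_def card_ge_0_finite)
      also have "\<dots> = (\<Sum>e\<in>M. 2)" using M by (intro sum.cong) (auto simp: fan_def)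
      finally show ?thesis using M by simp
    qed
    moreover have "finite (\<Union>M)" "x \<notin> \<Union>M"
      using M by (auto simp: fan_def card_ge_0_finite)
    ultimately show "card (f ` {0..2 * K}) = card {0..2 * K}" by simp
  qed simp
  show "graph_iso (friendship_graph K) H"
    using friendship_graph_image[OF inj] inj M f0 M'
    by (auto simp: graph_iso_def friendship_graph_def bij_betw_def intro!: exI[of _ f])
qed

lemma subgraph_friendship_graph_iff:
  assumes "simple_graph G"
  shows "(\<exists>H. subgraph H G \<and> graph_iso (friendship_graph K) H) \<longleftrightarrow>
    (\<exists>x M. fan x M \<and> card M = K \<and> x \<in> verts G \<and> fan_edges x M \<subseteq> edges G)"
proof -
  have "subgraph (insert x (\<Union>M), fan_edges x M) G \<longleftrightarrow> x \<in> verts G \<and> fan_edges x M \<subseteq> edges G"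
    if "fan x M" for x M
  proof -
    have "\<Union>M \<subseteq> verts G" if "fan_edges x M \<subseteq> edges G"
      using assms that by (fastforce simp: simple_graph_def nsets_def fan_edges_def)
    moreover have "simple_graph (insert x (\<Union>M), fan_edges x M)"
    proof -
      have "finite e" "e \<in> [insert x (\<Union>M)]\<^bsup>2\<^esup>" if "e \<in> M" for e
        using \<open>fan x M\<close> that by (auto simp: fan_def nsets_def card_ge_0_finite)
      then show ?thesis
        using \<open>fan x M\<close> by (auto simp: simple_graph_def fan_def fan_edges_def)
    qed
    ultimately show ?thesis using assms by (auto simp: subgraph_def)
  qed
  then show ?thesis unfolding graph_iso_friendship_graph_iff by blast
qed

section \<open>Turan numbers and colourings without rainbow fans\<close>

definition fan_free :: "nat \<Rightarrow> 'a set set \<Rightarrow> bool" where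
  "fan_free k E \<longleftrightarrow> (\<forall>x M. fan x M \<longrightarrow> fan_edges x M \<subseteq> E \<longrightarrow> card M < k)"

text \<open>Subsets of the matching of a fan again give fans, so a fan with at least
  \<open>k\<close> triangles contains one with exactly \<open>k\<close>.\<close>

lemma fan_freeI:
  assumes "\<And>x M. fan x M \<Longrightarrow> card M = k \<Longrightarrow> fan_edges x M \<subseteq> E \<Longrightarrow> False"
  shows "fan_free k E"
  unfolding fan_free_def
proof (intro allI impI, rule ccontr)
  fix x M assume M: "fan x M" "fan_edges x M \<subseteq> E" "\<not> card M < k"
  then obtain N where N: "N \<subseteq> M" "card N = k"
    using obtain_subset_with_card_n[of k M] by auto
  show False
    using assms[OF fan_subset[OF M(1) N(1)] N(2)] fan_edges_mono[OF N(1)] M(2) by (meson subset_trans)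
qed

lemma fan_free_mono: "fan_free k E \<Longrightarrow> F \<subseteq> E \<Longrightarrow> fan_free k F"
  unfolding fan_free_def by blast

text \<open>A spoke places the centre in \<open>V\<close>, which is why \<open>M\<close> has to be
  nonempty.\<close>

lemma fan_in_vertices:
  assumes "fan x M" "M \<noteq> {}" "fan_edges x M \<subseteq> [V]\<^bsup>2\<^esup>"
  shows "insert x (\<Union>M) \<subseteq> V"
proof -
  obtain e where e: "e \<in> M" using assms by blast
  then have "e \<noteq> {}" using assms(1) by (auto simp: fan_def)
  then obtain u where "u \<in> e" by blast
  then have "{x, u} \<in> [V]\<^bsup>2\<^esup>" using assms(3) e unfolding fan_edges_def by blast
  moreover have "M \<subseteq> [V]\<^bsup>2\<^esup>" using assms(3) by (auto simp: fan_edges_def)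
  ultimately show ?thesis by (auto simp: nsets_def)
qed

lemma friendship_graph_free_iff:
  assumes "simple_graph G" "k \<ge> 1"
  shows "(\<exists>H. subgraph H G \<and> graph_iso (friendship_graph k) H) \<longleftrightarrow> \<not> fan_free k (edges G)"
proof -
  have "x \<in> verts G" if M: "fan x M" "card M = k" "fan_edges x M \<subseteq> edges G" for x M
  proof -
    have "M \<noteq> {}" using M assms by auto
    then have "insert x (\<Union>M) \<subseteq> verts G"
      using M assms by (intro fan_in_vertices) (auto simp: simple_graph_def)
    then show ?thesis by simp
  qed
  then show ?thesis
    unfolding subgraph_friendship_graph_iff[OF assms(1)]
    by (metis fan_freeI fan_free_def less_irrefl)
qed

section \<open>Turan numbers through fan-free graphs\<close>

lemma finite_turan_set:
  "finite {card (edges G) | G :: nat graph. simple_graph G \<and> card (verts G) = n \<and> P G}"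
proof (rule finite_subset)
  show "{card (edges G) | G :: nat graph. simple_graph G \<and> card (verts G) = n \<and> P G} \<subseteq> {..n choose 2}"
  proof clarsimp
    fix V E assume *: "simple_graph (V :: nat set, E)"
    then have "card E \<le> card ([V]\<^bsup>2\<^esup>)"
      by (intro card_mono) (auto simp: simple_graph_def finite_imp_finite_nsets)
    then show "card E \<le> card V choose 2"
      by (simp add: card_nsets)
  qed
qed simp

lemma turan_number_ge:
  assumes "E \<subseteq> [{..<n}]\<^bsup>2\<^esup>" "fan_free k E" "k \<ge> 1"
  shows "card E \<le> turan_number n (friendship_graph k)"
  unfolding turan_number_def
proof (rule Max_ge[OF finite_turan_set], rule CollectI, intro exI conjI)
  show "simple_graph ({..<n}, E)" using assms by (simp add: simple_graph_def)
  then show "\<not> (\<exists>H. subgraph H ({..<n}, E) \<and> graph_iso (friendship_graph k) H)"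
    using assms by (subst friendship_graph_free_iff) auto
qed auto

text \<open>The extremal graph may live on any \<open>n\<close> natural numbers; it is pulled back
  to \<open>{..<n}\<close> along a bijection.\<close>

lemma turan_number_attained:
  assumes "k \<ge> 1"
  obtains E where "E \<subseteq> [{..<n}]\<^bsup>2\<^esup>" "fan_free k E"
    "card E = turan_number n (friendship_graph k)"
proof -
  let ?S = "{card (edges G) | G :: nat graph. simple_graph G \<and> card (verts G) = n \<and>
    \<not> (\<exists>H. subgraph H G \<and> graph_iso (friendship_graph k) H)}"
  have "fan_free k ({} :: nat set set)"
    using assms by (intro fan_freeI) (auto simp: fan_edges_def)
  \<comment> \<open>The empty graph shows that the maximum is taken over a nonempty set.\<close>
  then have "0 \<in> ?S"
    using friendship_graph_free_iff[of "({..<n}, {})" k] assms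
    by (intro CollectI exI[of _ "({..<n}, {})"]) (auto simp: simple_graph_def)
  then have "turan_number n (friendship_graph k) \<in> ?S"
    unfolding turan_number_def using finite_turan_set by (intro Max_in) auto
  then obtain G :: "nat graph" where G: "simple_graph G" "card (verts G) = n"
      "card (edges G) = turan_number n (friendship_graph k)" "fan_free k (edges G)"
    using friendship_graph_free_iff assms by (smt (verit) mem_Collect_eq)
  then obtain f where f: "bij_betw f {..<n} (verts G)"
    by (metis bij_betw_from_nat_into_finite lessThan_atLeast0 ex_bij_betw_nat_finite simple_graph_def)
  define E where "E = {e \<in> [{..<n}]\<^bsup>2\<^esup>. f ` e \<in> edges G}"
  have inj: "inj_on f {..<n}" and img: "f ` {..<n} = verts G" using f by (auto simp: bij_betw_def)
  have sub: "E \<subseteq> [{..<n}]\<^bsup>2\<^esup>" by (auto simp: E_def)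
  have "fan_free k E"
  proof (rule fan_freeI)
    fix x M assume M: "fan x M" "card M = k" "fan_edges x M \<subseteq> E"
    have "insert x (\<Union>M) \<subseteq> {..<n}"
    proof (rule fan_in_vertices[OF M(1)])
      show "M \<noteq> {}" using M assms by auto
    qed (use M sub in blast)
    then have "inj_on f (insert x (\<Union>M))" using inj inj_on_subset by blast
    note im = fan_image[OF M(1) this]
    have "fan_edges (f x) ((`) f ` M) \<subseteq> edges G"
      unfolding im(3) using M(3) by (auto simp: E_def)
    then show False using im(1,2) M G(4) unfolding fan_free_def by fastforce
  qed
  moreover have "(`) f ` E = edges G"
  proof
    show "edges G \<subseteq> (`) f ` E"
    proof
      fix e assume e: "e \<in> edges G"
      then have "e \<in> [verts G]\<^bsup>2\<^esup>" using G by (auto simp: simple_graph_def)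
      then obtain u v where uv: "e = {u, v}" "u \<in> verts G" "v \<in> verts G" "u \<noteq> v" by (rule nsets2_E)
      then obtain i j where ij: "u = f i" "v = f j" "i < n" "j < n" using img by (metis imageE lessThan_iff)
      then have "{i, j} \<in> E" "e = f ` {i, j}" using uv e by (auto simp: E_def)
      then show "e \<in> (`) f ` E" by blast
    qed
  qed (auto simp: E_def)
  moreover have "inj_on ((`) f) E"
    using inj sub by (intro inj_on_image inj_on_subset[OF inj]) (auto simp: nsets_def)
  ultimately show thesis
    using that[OF sub] G(3) by (metis card_image)
qed

text \<open>\<open>H\<close> is placed in one half \<open>P\<close> of a balanced complete bipartite
  graph. A fan centred in the other half has all its spokes ending in \<open>P\<close>, so its
  opposite edges form a matching of \<open>H\<close>. A fan centred in \<open>P\<close> has in each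
  triangle an edge of \<open>H\<close> at the centre, since no edge joins two vertices of the other
  half; the degree bounds their number.\<close>

lemma turan_number_ge_bipartite:
  assumes H: "H \<subseteq> [{..<n}]\<^bsup>2\<^esup>" "card (\<Union>H) \<le> n div 2"
    and deg: "\<And>x. degree H x < k" and mat: "\<And>M. matching H M \<Longrightarrow> card M < k"
  shows "n\<^sup>2 div 4 + card H \<le> turan_number n (friendship_graph k)"
proof -
  have "k \<ge> 1" using mat[of "{}"] by simp
  have Hn: "\<Union>H \<subseteq> {..<n}" using H by (auto simp: nsets_def)
  have "\<exists>P. \<Union>H \<subseteq> P \<and> P \<subseteq> {..<n} \<and> card P = n div 2"
    by (rule exists_subset_between[OF H(2) _ Hn]) auto
  then obtain P where P: "\<Union>H \<subseteq> P" "P \<subseteq> {..<n}" "card P = n div 2" by blast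
  define Q where "Q = {..<n} - P"
  have fin: "finite P" "finite Q" "finite H"
    using P(2) finite_edges[OF _ H(1)] by (auto simp: Q_def intro: finite_subset)
  have cQ: "card Q = n - n div 2"
    using P fin by (simp add: Q_def card_Diff_subset)
  define C where "C = (\<lambda>(p, q). {p, q}) ` (P \<times> Q)"
  have Ciff: "{a, b} \<in> C \<longleftrightarrow> a \<in> P \<and> b \<in> Q \<or> a \<in> Q \<and> b \<in> P" for a b
    by (auto simp: C_def image_iff doubleton_eq_iff)
  have PQ: "P \<inter> Q = {}" by (auto simp: Q_def)
  have HP: "a \<in> P \<and> b \<in> P" if "{a, b} \<in> H" for a b using that P by blast
  have "fan_free k (H \<union> C)"
  proof (rule fan_freeI)
    fix x M assume M: "fan x M" "card M = k" "fan_edges x M \<subseteq> H \<union> C"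
    have spoke: "{x, u} \<in> H \<union> C" if "e \<in> M" "u \<in> e" for e u
      using that M by (auto simp: fan_edges_def)
    have pair: "\<exists>u v. e = {u, v} \<and> u \<noteq> v" "e \<in> H \<union> C" if "e \<in> M" for e
      using M that by (auto simp: fan_def fan_edges_def card_2_iff)
    have PQ': "u \<in> P \<or> u \<in> Q" if "e \<in> M" "u \<in> e" for e u
      using spoke[OF that] HP[of x u] Ciff[of x u] by blast
    show False
    proof (cases "x \<in> P")
      case False
      have "e \<in> H" if e: "e \<in> M" for e
      proof -
        obtain u v where uv: "e = {u, v}" using pair[OF e] by blast
        have "u \<in> P" "v \<in> P"
          using spoke[OF e, of u] spoke[OF e, of v] uv False HP[of x u] HP[of x v] Ciff[of x u] Ciff[of x v]
          by auto
        then show ?thesis using pair(2)[OF e] uv Ciff[of u v] PQ by blast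
      qed
      then have "matching H M" using M by (auto simp: matching_def fan_def)
      then show False using mat M by blast
    next
      case True
      have "\<exists>u\<in>e. {x, u} \<in> H" if e: "e \<in> M" for e
      proof -
        obtain u v where uv: "e = {u, v}" using pair[OF e] by blast
        then have "u \<in> P \<or> v \<in> P"
          using pair(2)[OF e] HP[of u v] Ciff[of u v] by blast
        then show ?thesis
          using spoke[OF e, of u] spoke[OF e, of v] uv True Ciff[of x u] Ciff[of x v] PQ by blast
      qed
      then obtain g where g: "\<And>e. e \<in> M \<Longrightarrow> g e \<in> e \<and> {x, g e} \<in> H" by metis
      have "inj_on (\<lambda>e. {x, g e}) M"
      proof (rule inj_onI)
        fix e e' assume *: "e \<in> M" "e' \<in> M" "{x, g e} = {x, g e'}"
        then have "g e = g e'" by (metis doubleton_eq_iff)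
        then have "\<not> disjnt e e'" using g[OF *(1)] g[OF *(2)] by (auto simp: disjnt_def)
        then show "e = e'" using M(1) *(1,2) by (auto simp: fan_def pairwise_def)
      qed
      moreover have "(\<lambda>e. {x, g e}) ` M \<subseteq> {h \<in> H. x \<in> h}" using g by auto
      ultimately have "card M \<le> degree H x"
        unfolding degree_def using fin by (intro card_inj_on_le) auto
      then show False using deg[of x] M by simp
    qed
  qed
  moreover have "H \<union> C \<subseteq> [{..<n}]\<^bsup>2\<^esup>"
    using H P PQ by (auto simp: C_def Q_def)
  ultimately have "card (H \<union> C) \<le> turan_number n (friendship_graph k)"
    using turan_number_ge \<open>k \<ge> 1\<close> by blast
  moreover have "card (H \<union> C) = card H + card C"
  proof (rule card_Un_disjoint)
    have False if e: "e \<in> H" "e \<in> C" for e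
    proof -
      obtain p q where "e = {p, q}" "q \<in> Q" using e(2) by (auto simp: C_def)
      then show False using HP[of p q] e(1) PQ by blast
    qed
    then show "H \<inter> C = {}" by blast
  qed (use fin in \<open>auto simp: C_def\<close>)
  moreover have "card C = n\<^sup>2 div 4"
  proof -
    have "card C = card (P \<times> Q)"
      unfolding C_def using PQ by (intro card_image) (auto simp: inj_on_def doubleton_eq_iff)
    also have "\<dots> = (n div 2) * (n - n div 2)" using P cQ by (simp add: card_cartesian_product)
    also have "\<dots> = n\<^sup>2 div 4"
      by (cases "even n") (auto elim!: evenE oddE simp: power2_eq_square algebra_simps)
    finally show ?thesis .
  qed
  ultimately show ?thesis by simp
qed

lemma matching_card_Union:
  assumes "E \<subseteq> [V]\<^bsup>2\<^esup>" "matching E M"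
  shows "card (\<Union>M) = 2 * card M"
proof -
  have "card (\<Union>M) = (\<Sum>e\<in>M. card e)"
    using assms by (intro card_Union_disjoint) (auto simp: matching_def nsets_def)
  also have "\<dots> = (\<Sum>e\<in>M. 2)"
    using assms by (intro sum.cong) (auto simp: matching_def nsets_def)
  finally show ?thesis by simp
qed

text \<open>\<open>H\<close> is the disjoint union of complete graphs on \<open>k\<close> and
  \<open>k - 1\<close> vertices: degrees are at most \<open>k - 1\<close>, the
  \<open>2 * k - 1\<close> vertices leave no room for \<open>k\<close> disjoint edges, and
  \<open>k choose 2\<close> and \<open>(k - 1) choose 2\<close> add up to the square.\<close>

lemma turan_number_ge_square:
  assumes "k \<ge> 1" "n \<ge> 4 * k"
  shows "n\<^sup>2 div 4 + (k - 1)\<^sup>2 \<le> turan_number n (friendship_graph k)"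
proof -
  let ?X = "{..<k}" and ?Y = "{k..<2 * k - 1}"
  define H where "H = [?X]\<^bsup>2\<^esup> \<union> [?Y]\<^bsup>2\<^esup>"
  have sub: "H \<subseteq> [{..<2 * k - 1}]\<^bsup>2\<^esup>" using assms by (auto simp: H_def nsets_def)
  have disj: "[?X]\<^bsup>2\<^esup> \<inter> [?Y]\<^bsup>2\<^esup> = {}"
  proof -
    have False if "e \<in> [?X]\<^bsup>2\<^esup>" "e \<in> [?Y]\<^bsup>2\<^esup>" for e
      using that by (auto elim!: nsets2_E simp: doubleton_eq_iff)
    then show ?thesis by blast
  qed
  have fin: "finite H" by (simp add: H_def finite_imp_finite_nsets)
  have "n\<^sup>2 div 4 + card H \<le> turan_number n (friendship_graph k)"
  proof (rule turan_number_ge_bipartite)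
    show "H \<subseteq> [{..<n}]\<^bsup>2\<^esup>" using sub assms nsets_mono[of "{..<2 * k - 1}" "{..<n}" 2] by force
    have "card (\<Union>H) \<le> card {..<2 * k - 1}"
      using sub by (intro card_mono) (auto simp: nsets_def)
    then show "card (\<Union>H) \<le> n div 2" using assms by simp
    show "degree H x < k" for x
    proof -
      have "degree H x \<le> degree ([?X]\<^bsup>2\<^esup>) x + degree ([?Y]\<^bsup>2\<^esup>) x"
        unfolding degree_def H_def
        by (rule order_trans[OF _ card_Un_le]) (auto intro!: card_mono simp: finite_imp_finite_nsets)
      moreover have "degree ([?X]\<^bsup>2\<^esup>) x = 0 \<or> degree ([?Y]\<^bsup>2\<^esup>) x = 0"
      proof (cases "x < k")
        case True
        then have "{e \<in> [?Y]\<^bsup>2\<^esup>. x \<in> e} = {}" by (auto simp: nsets_def)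
        then show ?thesis unfolding degree_def by (metis card.empty)
      next
        case False
        then have "{e \<in> [?X]\<^bsup>2\<^esup>. x \<in> e} = {}" by (auto simp: nsets_def)
        then show ?thesis unfolding degree_def by (metis card.empty)
      qed
      ultimately show ?thesis
        using degree_le_card[of ?X "[?X]\<^bsup>2\<^esup>" x] degree_le_card[of ?Y "[?Y]\<^bsup>2\<^esup>" x] assms by auto
    qed
    show "card M < k" if "matching H M" for M
    proof -
      have "card (\<Union>M) \<le> card {..<2 * k - 1}"
        using sub that by (intro card_mono) (auto simp: nsets_def matching_def)
      then show ?thesis using matching_card_Union[OF sub that] assms by simp
    qed
  qed
  moreover have "card H = (k - 1)\<^sup>2"
  proof -
    obtain j where j: "k = Suc j" using assms by (cases k) auto
    have "card H = (k choose 2) + ((k - 1) choose 2)"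
      unfolding H_def using disj by (subst card_Un_disjoint) (auto simp: card_nsets finite_imp_finite_nsets)
    also have "\<dots> = j\<^sup>2"
    proof -
      have "(Suc i choose 2) + (i choose 2) = i\<^sup>2" for i :: nat
        by (induction i) (simp_all add: numeral_2_eq_2)
      then show ?thesis by (simp add: j)
    qed
    finally show ?thesis using j by simp
  qed
  ultimately show ?thesis by simp
qed

section \<open>Rainbow fans and the colouring for the lower bound\<close>

lemma fan_edges_in_vertices:
  assumes "fan x M" "insert x (\<Union>M) \<subseteq> V"
  shows "fan_edges x M \<subseteq> [V]\<^bsup>2\<^esup>"
proof -
  have "e \<in> [V]\<^bsup>2\<^esup>" if "e \<in> M" for e
    using assms that by (auto simp: fan_def nsets_def card_ge_0_finite)
  moreover have "{x, u} \<in> [V]\<^bsup>2\<^esup>" if "u \<in> \<Union>M" for u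
    using assms that by (auto simp: fan_def)
  ultimately show ?thesis unfolding fan_edges_def by blast
qed

definition rainbow_fan :: "('a set \<Rightarrow> 'c) \<Rightarrow> 'a set \<Rightarrow> 'a \<Rightarrow> 'a set set \<Rightarrow> bool" where
  "rainbow_fan c V x M \<longleftrightarrow> fan x M \<and> fan_edges x M \<subseteq> [V]\<^bsup>2\<^esup> \<and> inj_on c (fan_edges x M)"

lemma rainbow_fan_subset: "rainbow_fan c V x M \<Longrightarrow> N \<subseteq> M \<Longrightarrow> rainbow_fan c V x N"
  unfolding rainbow_fan_def using fan_subset fan_edges_mono
  by (metis inj_on_subset subset_trans)

lemma rainbow_friendship_graph_iff:
  assumes "k \<ge> 1"
  shows "(\<exists>G\<in>{friendship_graph k}. \<exists>H. subgraph H (complete_graph n) \<and> graph_iso G H \<and> rainbow c H)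
    \<longleftrightarrow> (\<exists>x M. rainbow_fan c {..<n} x M \<and> card M = k)"
proof -
  have simple: "simple_graph (complete_graph n)" by (simp add: simple_graph_def complete_graph_def)
  have *: "subgraph (insert x (\<Union>M), fan_edges x M) (complete_graph n) \<longleftrightarrow> fan_edges x M \<subseteq> [{..<n}]\<^bsup>2\<^esup>"
    if M: "fan x M" "card M = k" for x M
  proof
    assume "fan_edges x M \<subseteq> [{..<n}]\<^bsup>2\<^esup>"
    moreover have "M \<noteq> {}" using M assms by auto
    ultimately have "insert x (\<Union>M) \<subseteq> {..<n}" using fan_in_vertices[OF M(1)] by blast
    moreover have "simple_graph (insert x (\<Union>M), fan_edges x M)"
      using fan_edges_in_vertices[OF M(1) subset_refl] \<open>insert x (\<Union>M) \<subseteq> {..<n}\<close>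
      by (auto simp: simple_graph_def dest: finite_subset[OF _ finite_lessThan])
    ultimately show "subgraph (insert x (\<Union>M), fan_edges x M) (complete_graph n)"
      using simple \<open>fan_edges x M \<subseteq> _\<close> by (simp add: subgraph_def complete_graph_def)
  qed (auto simp: subgraph_def complete_graph_def)
  show ?thesis (is "?L \<longleftrightarrow> ?R")
  proof
    assume ?L
    then obtain x M where "fan x M" "card M = k" "rainbow c (insert x (\<Union>M), fan_edges x M)"
        "subgraph (insert x (\<Union>M), fan_edges x M) (complete_graph n)"
      by (auto simp: graph_iso_friendship_graph_iff)
    then show ?R using * unfolding rainbow_fan_def rainbow_def by auto
  next
    assume ?R
    then obtain x M where M: "fan x M" "card M = k" "rainbow_fan c {..<n} x M"
      by (auto simp: rainbow_fan_def)
    then have "subgraph (insert x (\<Union>M), fan_edges x M) (complete_graph n)"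
      "graph_iso (friendship_graph k) (insert x (\<Union>M), fan_edges x M)"
      "rainbow c (insert x (\<Union>M), fan_edges x M)"
      using * by (auto simp: rainbow_fan_def rainbow_def graph_iso_friendship_graph_iff)
    then show ?L by blast
  qed
qed

text \<open>Guarantees an edge outside any fan-free graph, so that the extra colour of the lower
  bound really occurs.\<close>

lemma not_fan_free_complete:
  assumes "n \<ge> 2 * k + 1"
  shows "\<not> fan_free k ([{..<n}]\<^bsup>2\<^esup>)"
proof -
  let ?M = "(\<lambda>i. {id (2 * i - 1), id (2 * i)}) ` {1..k}"
  have inj: "inj_on id {0..2 * k}" by simp
  note M = friendship_graph_image[OF inj]
  have "insert (id 0) (\<Union>?M) \<subseteq> {..<n}"
    unfolding M(3)[symmetric] using assms by auto
  then have "fan_edges (id 0) ?M \<subseteq> [{..<n}]\<^bsup>2\<^esup>"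
    by (rule fan_edges_in_vertices[OF M(1)])
  then show ?thesis
    using M(1,2) unfolding fan_free_def by (metis less_irrefl)
qed

text \<open>Since \<open>anti_ramsey\<close> is a least value, every positive number of colours
  below the claimed one needs a colouring. A subgraph with \<open>r - 1\<close> edges of an extremal
  graph is coloured injectively, and all other edges get one extra colour.\<close>

lemma colouring_without_rainbow_fan:
  assumes k: "k \<ge> 1" and n: "n \<ge> 2 * k + 1"
    and r: "1 \<le> r" "r \<le> turan_number n (friendship_graph k) + 1"
  shows "\<exists>c :: nat set \<Rightarrow> nat. card (c ` [{..<n}]\<^bsup>2\<^esup>) = r \<and>
    \<not> (\<exists>x M. rainbow_fan c {..<n} x M \<and> card M = k + 1)"
proof -
  obtain E0 where E0: "E0 \<subseteq> [{..<n}]\<^bsup>2\<^esup>" "fan_free k E0" "card E0 = turan_number n (friendship_graph k)"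
    using turan_number_attained[OF k] by metis
  have "r - 1 \<le> card E0" using r E0 by simp
  then obtain E where E: "E \<subseteq> E0" "card E = r - 1"
    by (rule obtain_subset_with_card_n)
  then have free: "fan_free k E" and sub: "E \<subseteq> [{..<n}]\<^bsup>2\<^esup>" using E0 fan_free_mono by auto
  have finE: "finite E" using sub finite_edges by blast
  obtain h where h: "bij_betw h E {0..<r - 1}"
    using ex_bij_betw_finite_nat[OF finE] E by auto
  \<comment> \<open>\<open>Suc\<close> reserves the colour \<open>0\<close> for the edges outside
    \<open>E\<close>.\<close>
  define c where "c e = (if e \<in> E then Suc (h e) else 0)" for e
  have "[{..<n}]\<^bsup>2\<^esup> \<noteq> E" using free not_fan_free_complete[OF n] by auto
  then obtain e0 where e0: "e0 \<in> [{..<n}]\<^bsup>2\<^esup>" "e0 \<notin> E" using sub by blast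
  have "c ` [{..<n}]\<^bsup>2\<^esup> = insert 0 (Suc ` {0..<r - 1})"
  proof -
    have "c ` [{..<n}]\<^bsup>2\<^esup> = c ` E \<union> c ` ([{..<n}]\<^bsup>2\<^esup> - E)" using sub by blast
    also have "c ` E = Suc ` h ` E" by (auto simp: c_def)
    also have "h ` E = {0..<r - 1}" using h by (simp add: bij_betw_def)
    also have "c ` ([{..<n}]\<^bsup>2\<^esup> - E) = {0}" using e0 by (auto simp: c_def)
    finally show ?thesis by simp
  qed
  also have "card \<dots> = r" using r by (simp add: card_image)
  finally have "card (c ` [{..<n}]\<^bsup>2\<^esup>) = r" .
  moreover have False if M: "rainbow_fan c {..<n} x M" "card M = k + 1" for x M
  proof -
    have fan: "fan x M" and inj: "inj_on c (fan_edges x M)" using M by (auto simp: rainbow_fan_def)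
    have same: "f = f'" if "f \<in> fan_edges x M - E" "f' \<in> fan_edges x M - E" for f f'
      using inj that by (auto simp: c_def inj_on_def)
    \<comment> \<open>At most one edge of a rainbow fan has the extra colour, and it belongs to a
      single triangle. Dropping that triangle leaves \<open>k\<close> triangles inside
      \<open>E\<close>.\<close>
    have "\<exists>e\<in>M. fan_edges x (M - {e}) \<subseteq> E"
    proof (cases "fan_edges x M \<subseteq> E")
      case True
      moreover obtain e where "e \<in> M" using M(2) by fastforce
      ultimately show ?thesis using fan_edges_mono[of "M - {e}" M x] by blast
    next
      case False
      then obtain f where f: "f \<in> fan_edges x M - E" by blast
      then obtain e where e: "e \<in> M" "f = e \<or> (\<exists>u\<in>e. f = {x, u})"
        by (auto simp: fan_edges_def)
      have "f \<notin> fan_edges x (M - {e})"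
      proof
        assume "f \<in> fan_edges x (M - {e})"
        then obtain e' where e': "e' \<in> M" "e' \<noteq> e" "f = e' \<or> (\<exists>u\<in>e'. f = {x, u})"
          by (auto simp: fan_edges_def)
        have "e \<inter> e' = {}" "x \<notin> e" "x \<notin> e'"
          using fan e(1) e'(1,2) by (auto simp: fan_def pairwise_def disjnt_def)
        then show False using e(2) e'(2,3) by (auto simp: doubleton_eq_iff)
      qed
      then have "fan_edges x (M - {e}) \<subseteq> E"
        using fan_edges_mono[of "M - {e}" M x] f same by blast
      then show ?thesis using e by blast
    qed
    then obtain e where e: "e \<in> M" "fan_edges x (M - {e}) \<subseteq> E" by blast
    have "card (M - {e}) < k"
      using free fan_subset[OF fan, of "M - {e}"] e(2) unfolding fan_free_def by blast
    moreover have "finite M" using fan by (simp add: fan_def)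
    ultimately show False using M(2) e(1) by simp
  qed
  ultimately show ?thesis by blast
qed

section \<open>Dense graphs without large fans\<close>

definition nbrs :: "'a set set \<Rightarrow> 'a \<Rightarrow> 'a set" where
  "nbrs E x = {y. {x, y} \<in> E}"

lemma nbrs_subset:
  assumes "E \<subseteq> [V]\<^bsup>2\<^esup>"
  shows "nbrs E x \<subseteq> V - {x}"
proof
  fix y assume "y \<in> nbrs E x"
  then have "{x, y} \<in> [V]\<^bsup>2\<^esup>" using assms unfolding nbrs_def by blast
  then show "y \<in> V - {x}" by auto
qed

lemma nbrs_sym: "y \<in> nbrs E x \<longleftrightarrow> x \<in> nbrs E y"
  by (simp add: nbrs_def insert_commute)

lemma finite_nbrs: "finite V \<Longrightarrow> E \<subseteq> [V]\<^bsup>2\<^esup> \<Longrightarrow> finite (nbrs E x)"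
  using nbrs_subset[of E V x] by (auto intro: finite_subset)

lemma degree_eq_card_nbrs:
  assumes "E \<subseteq> [V]\<^bsup>2\<^esup>"
  shows "degree E x = card (nbrs E x)"
proof -
  have "{e \<in> E. x \<in> e} = (\<lambda>y. {x, y}) ` nbrs E x"
  proof (intro equalityI subsetI)
    fix e assume e: "e \<in> {e \<in> E. x \<in> e}"
    then obtain y where "e = {x, y}" using assms by (auto elim: edge_other_end)
    then show "e \<in> (\<lambda>y. {x, y}) ` nbrs E x" using e by (auto simp: nbrs_def)
  qed (auto simp: nbrs_def)
  moreover have "inj_on (\<lambda>y. {x, y}) (nbrs E x)"
    by (auto simp: inj_on_def doubleton_eq_iff)
  ultimately show ?thesis by (simp add: degree_def card_image)
qed

lemma nbrs_within: "x \<in> A \<Longrightarrow> nbrs {e \<in> E. e \<subseteq> A} x = nbrs E x \<inter> A"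
  by (auto simp: nbrs_def)

text \<open>Greedy choice: when an element is treated, fewer values are in use than its set has
  elements.\<close>

lemma distinct_representatives:
  assumes "finite D"
  shows "(\<And>d. d \<in> D \<Longrightarrow> finite (S d) \<and> card D \<le> card (S d)) \<Longrightarrow>
    \<exists>f. inj_on f D \<and> (\<forall>d\<in>D. f d \<in> S d)"
  using assms
proof (induction D rule: finite_induct)
  case (insert d D)
  have "finite (S x) \<and> card D \<le> card (S x)" if "x \<in> D" for x
    using insert.prems[of x] insert.hyps that by auto
  then obtain f where f: "inj_on f D" "\<forall>x\<in>D. f x \<in> S x" using insert.IH by blast
  have "card (f ` D) < card (S d)"
    using insert.prems[of d] insert.hyps card_image_le[of D f] by auto
  then obtain y where y: "y \<in> S d" "y \<notin> f ` D"
    using insert.hyps by (meson card_mono finite_imageI not_less subsetI)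
  have "inj_on (f(d := y)) (insert d D)"
    using f(1) y(2) insert.hyps by (auto simp: inj_on_def)
  moreover have "\<forall>x\<in>insert d D. (f(d := y)) x \<in> S x" using f(2) y(1) insert.hyps by auto
  ultimately show ?case by blast
qed auto

lemma fan_add_triangles:
  assumes "finite D"
  shows "fan x M \<Longrightarrow> inj_on f D \<Longrightarrow> x \<notin> D \<Longrightarrow> x \<notin> f ` D \<Longrightarrow> D \<inter> f ` D = {} \<Longrightarrow>
    (D \<union> f ` D) \<inter> \<Union>M = {} \<Longrightarrow>
    fan x (M \<union> (\<lambda>d. {d, f d}) ` D) \<and> card (M \<union> (\<lambda>d. {d, f d}) ` D) = card M + card D"
  using assms
proof (induction D rule: finite_induct)
  case (insert d D)
  let ?N = "M \<union> (\<lambda>d. {d, f d}) ` D"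
  have N: "fan x ?N" "card ?N = card M + card D"
    using insert.IH insert.prems by (auto simp: inj_on_def)
  have dN: "d \<notin> \<Union>?N"
  proof -
    have "d \<notin> \<Union>M" "d \<notin> D" "d \<notin> f ` D" using insert.prems insert.hyps by auto
    then show ?thesis by auto
  qed
  have fdN: "f d \<notin> \<Union>?N"
  proof -
    have "f d \<notin> \<Union>M" "f d \<notin> D" using insert.prems by auto
    moreover have "f d \<notin> f ` D" using insert.prems(2) insert.hyps by auto
    ultimately show ?thesis by auto
  qed
  have "fan x (insert {d, f d} ?N)"
    using insert.prems by (intro fan_insert[OF N(1) _ _ _ dN fdN]) auto
  moreover have "{d, f d} \<notin> ?N" using dN by auto
  moreover have "finite ?N" using N(1) by (simp add: fan_def)
  ultimately show ?case using N(2) insert.hyps by simp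
qed simp

lemma fan_edges_add_triangles:
  "fan_edges x (M \<union> (\<lambda>d. {d, f d}) ` D) = fan_edges x M \<union> (\<Union>d\<in>D. {{d, f d}, {x, d}, {x, f d}})"
  by (auto simp: fan_edges_def)

lemma fan_empty [simp]: "fan x {}" "fan_edges x {} = {}"
  by (auto simp: fan_def fan_edges_def)

text \<open>For \<open>k + 1\<close> elements of \<open>D\<close>, distinct partners in
  \<open>Y\<close> could be chosen, which would make a fan with \<open>k + 1\<close> triangles at
  \<open>x\<close>.\<close>

lemma few_common_neighbours:
  assumes V: "finite V" "E \<subseteq> [V]\<^bsup>2\<^esup>" and free: "fan_free (Suc k) E"
    and D: "D \<subseteq> nbrs E x" "D \<inter> Y = {}"
    and Y: "\<And>d. d \<in> D \<Longrightarrow> Suc k \<le> card (nbrs E x \<inter> nbrs E d \<inter> Y)"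
  shows "card D \<le> k"
proof (rule ccontr)
  assume "\<not> card D \<le> k"
  then have "Suc k \<le> card D" by simp
  then obtain D' where D': "D' \<subseteq> D" "card D' = Suc k" "finite D'"
    by (rule obtain_subset_with_card_n)
  have "finite (nbrs E x \<inter> nbrs E d \<inter> Y) \<and> card D' \<le> card (nbrs E x \<inter> nbrs E d \<inter> Y)" if "d \<in> D'" for d
    using finite_nbrs[OF V] Y[of d] D' that by auto
  then obtain f where f: "inj_on f D'" "\<forall>d\<in>D'. f d \<in> nbrs E x \<inter> nbrs E d \<inter> Y"
    using distinct_representatives[OF D'(3), of "\<lambda>d. nbrs E x \<inter> nbrs E d \<inter> Y"] by blast
  let ?M = "{} \<union> (\<lambda>d. {d, f d}) ` D'"
  have x: "x \<notin> nbrs E x" using nbrs_subset[OF V(2), of x] by blast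
  have "fan x ?M \<and> card ?M = card ({} :: 'a set set) + card D'"
  proof (rule fan_add_triangles[OF D'(3) fan_empty(1) f(1)])
    show "x \<notin> D'" using x D(1) D'(1) by blast
    show "x \<notin> f ` D'" using x f(2) by auto
    show "D' \<inter> f ` D' = {}" using f(2) D(2) D'(1) by auto
  qed simp
  moreover have "fan_edges x ?M \<subseteq> E"
    unfolding fan_edges_add_triangles
  proof -
    have "{{d, f d}, {x, d}, {x, f d}} \<subseteq> E" if "d \<in> D'" for d
      using f(2) D(1) D'(1) that by (auto simp: nbrs_def)
    then show "fan_edges x {} \<union> (\<Union>d\<in>D'. {{d, f d}, {x, d}, {x, f d}}) \<subseteq> E" by auto
  qed
  ultimately have "card ({} :: 'a set set) + card D' < Suc k"
    using free unfolding fan_free_def by metis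
  then show False using D'(2) by simp
qed

text \<open>A maximum matching inside the neighbourhood forms a fan with \<open>x\<close>, so it has
  at most \<open>k\<close> edges; the neighbours it leaves uncovered are independent.\<close>

lemma independent_neighbours:
  assumes V: "finite V" "E \<subseteq> [V]\<^bsup>2\<^esup>" and free: "fan_free (Suc k) E"
  obtains I where "I \<subseteq> nbrs E x" "card (nbrs E x) \<le> card I + 2 * k" "\<And>e. e \<in> E \<Longrightarrow> \<not> e \<subseteq> I"
proof -
  let ?F = "{e \<in> E. e \<subseteq> nbrs E x}"
  have finE: "finite E" using finite_edges V by blast
  then have finF: "finite ?F" by simp
  obtain M where M: "max_matching ?F M" using max_matching_exists[OF finF] ..
  then have mM: "matching ?F M" "card M = matching_number ?F" "M \<subseteq> ?F" "finite M"
    using finF by (auto simp: max_matching_def matching_def intro: finite_subset)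
  have FV: "?F \<subseteq> [V]\<^bsup>2\<^esup>" using V by blast
  have sub: "\<Union>M \<subseteq> nbrs E x" using mM(3) by blast
  have x: "x \<notin> nbrs E x" using nbrs_subset[OF V(2), of x] by blast
  have "fan x M"
    unfolding fan_def
  proof (intro conjI ballI)
    show "card e = 2" if "e \<in> M" for e using that mM(3) FV by (auto simp: nsets_def)
    show "pairwise disjnt M" using mM(1) by (simp add: matching_def)
    show "x \<notin> \<Union>M" using x sub by blast
  qed (rule mM(4))
  moreover have "fan_edges x M \<subseteq> E"
  proof -
    have "{x, u} \<in> E" if "u \<in> \<Union>M" for u using sub that by (auto simp: nbrs_def)
    then show ?thesis using mM(3) by (auto simp: fan_edges_def)
  qed
  ultimately have "card M < Suc k" using free unfolding fan_free_def by blast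
  then have "card (\<Union>M) \<le> 2 * k" using matching_card_Union[OF FV mM(1)] by simp
  moreover have "card (nbrs E x - \<Union>M) = card (nbrs E x) - card (\<Union>M)"
    using sub finite_nbrs[OF V, of x] by (intro card_Diff_subset) (auto intro: finite_subset)
  ultimately have "card (nbrs E x) \<le> card (nbrs E x - \<Union>M) + 2 * k" by simp
  moreover have False if e: "e \<in> E" "e \<subseteq> nbrs E x - \<Union>M" for e
  proof -
    have "matching ?F (insert e M)"
      using e by (intro matching_insert[OF mM(1)]) auto
    then have "card (insert e M) \<le> card M" using matching_number_ge[OF finF] mM(2) by simp
    moreover have "e \<notin> M"
    proof
      assume "e \<in> M"
      then have "e = {}" using e(2) by blast
      then show False using e(1) V(2) by (auto simp: nsets_def)
    qed
    ultimately show False using mM(4) by simp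
  qed
  ultimately show thesis using that[of "nbrs E x - \<Union>M"] by blast
qed

text \<open>Each edge inside \<open>A\<close> has an end outside the independent set
  \<open>I\<close> and is charged to that end.\<close>

lemma card_inside_edges_le:
  assumes V: "finite V" "E \<subseteq> [V]\<^bsup>2\<^esup>" and A: "A \<subseteq> V"
    and I: "\<And>e. e \<in> E \<Longrightarrow> \<not> e \<subseteq> I" and deg: "\<And>x. x \<in> A \<Longrightarrow> card (nbrs E x \<inter> A) \<le> k"
  shows "card {e \<in> E. e \<subseteq> A} \<le> card (A - I) * k"
proof -
  have finA: "finite (A - I)" using A V(1) finite_subset by blast
  have "{e \<in> E. e \<subseteq> A} \<subseteq> (\<Union>r\<in>A - I. (\<lambda>y. {r, y}) ` (nbrs E r \<inter> A))"
  proof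
    fix e assume e: "e \<in> {e \<in> E. e \<subseteq> A}"
    then obtain r where r: "r \<in> e" "r \<notin> I" using I by blast
    have "e \<in> [V]\<^bsup>2\<^esup>" using e V(2) by blast
    then obtain y where y: "e = {r, y}" using r(1) by (rule edge_other_end)
    then have "r \<in> A - I" "y \<in> nbrs E r \<inter> A" using e r by (auto simp: nbrs_def)
    then show "e \<in> (\<Union>r\<in>A - I. (\<lambda>y. {r, y}) ` (nbrs E r \<inter> A))" using y by blast
  qed
  then have "card {e \<in> E. e \<subseteq> A} \<le> card (\<Union>r\<in>A - I. (\<lambda>y. {r, y}) ` (nbrs E r \<inter> A))"
    using finA finite_nbrs[OF V] by (intro card_mono) auto
  also have "\<dots> \<le> (\<Sum>r\<in>A - I. card ((\<lambda>y. {r, y}) ` (nbrs E r \<inter> A)))"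
    by (rule card_UN_le[OF finA])
  also have "\<dots> \<le> (\<Sum>r\<in>A - I. k)"
  proof (rule sum_mono)
    fix r assume "r \<in> A - I"
    then have "card (nbrs E r \<inter> A) \<le> k" using deg by simp
    moreover have "card ((\<lambda>y. {r, y}) ` (nbrs E r \<inter> A)) \<le> card (nbrs E r \<inter> A)"
      using finite_nbrs[OF V] by (intro card_image_le) auto
    ultimately show "card ((\<lambda>y. {r, y}) ` (nbrs E r \<inter> A)) \<le> k" by simp
  qed
  also have "\<dots> = card (A - I) * k" by simp
  finally show ?thesis .
qed

section \<open>The bipartition of a dense graph without large fans\<close>

locale dense_fan_free =
  fixes V :: "'a set" and E :: "'a set set" and k m :: nat
  assumes finV: "finite V" and EV: "E \<subseteq> [V]\<^bsup>2\<^esup>" and cardV: "card V = m"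
    and free: "fan_free (Suc k) E"
    and min_degree: "x \<in> V \<Longrightarrow> m div 2 \<le> card (nbrs E x)"
begin

lemma finN: "finite (nbrs E x)"
  using finite_nbrs[OF finV EV] .

text \<open>All neighbours of \<open>i\<close> lie outside the independent set \<open>I\<close>. Of
  the \<open>m - card I\<close> vertices there at least \<open>m div 2\<close> are neighbours, and
  the rest bounds what \<open>i\<close> can miss in \<open>J\<close>.\<close>

lemma independent_missing:
  assumes "I \<subseteq> V" "\<And>e. e \<in> E \<Longrightarrow> \<not> e \<subseteq> I" "i \<in> I" "J \<subseteq> V - I"
  shows "nbrs E i \<subseteq> V - I" "card (J - nbrs E i) + card I + m div 2 \<le> m"
proof -
  show sub: "nbrs E i \<subseteq> V - I"
    using nbrs_subset[OF EV, of i] assms(2,3) by (auto simp: nbrs_def)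
  have "card (J - nbrs E i) \<le> card ((V - I) - nbrs E i)"
    using assms(4) finV by (intro card_mono) auto
  also have "\<dots> = card (V - I) - card (nbrs E i)"
    using sub finN by (intro card_Diff_subset) auto
  also have "card (V - I) = m - card I"
    using assms(1) finV cardV by (subst card_Diff_subset) (auto intro: finite_subset)
  finally have "card (J - nbrs E i) \<le> m - card I - card (nbrs E i)" .
  moreover have "card I \<le> m" using assms(1) finV cardV card_mono by blast
  moreover have "card (nbrs E i) \<le> m - card I"
    using card_mono[OF _ sub] finV assms(1) cardV
    by (simp add: card_Diff_subset finite_subset)
  moreover have "m div 2 \<le> card (nbrs E i)" using min_degree assms(1,3) by blast
  ultimately show "card (J - nbrs E i) + card I + m div 2 \<le> m" by linarith
qed

text \<open>The neighbourhood of \<open>x\<close> contains an independent set smaller by at most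
  \<open>2 * k\<close>, and by \<open>independent_missing\<close> with \<open>J\<close> empty such a
  set has at most \<open>m - m div 2\<close> vertices.\<close>

lemma max_degree: "card (nbrs E x) + m div 2 \<le> m + 2 * k"
proof -
  obtain I where I: "I \<subseteq> nbrs E x" "card (nbrs E x) \<le> card I + 2 * k" "\<And>e. e \<in> E \<Longrightarrow> \<not> e \<subseteq> I"
    using independent_neighbours[OF finV EV free] by metis
  show ?thesis
  proof (cases "I = {}")
    case False
    then obtain i where "i \<in> I" by blast
    moreover have "I \<subseteq> V" using I(1) nbrs_subset[OF EV, of x] by blast
    ultimately have "card ({} - nbrs E i) + card I + m div 2 \<le> m"
      using I(3) by (intro independent_missing) auto
    then show ?thesis using I(2) by simp
  qed (use I(2) in auto)
qed

text \<open>The resulting bound on \<open>card E\<close> is about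
  \<open>m\<^sup>2 div 4 + k * m\<close>; it serves to exclude a small \<open>m\<close>.\<close>

lemma card_edges_le: "2 * card E + m * (m div 2) \<le> m * (m + 2 * k)"
proof -
  have "2 * card E + m * (m div 2) = (\<Sum>x\<in>V. degree E x) + (\<Sum>x\<in>V. m div 2)"
    using sum_degree[OF finV EV] cardV by simp
  also have "\<dots> = (\<Sum>x\<in>V. card (nbrs E x) + m div 2)"
    by (simp add: sum.distrib degree_eq_card_nbrs[OF EV])
  also have "\<dots> \<le> (\<Sum>x\<in>V. m + 2 * k)" by (rule sum_mono) (rule max_degree)
  also have "\<dots> = m * (m + 2 * k)" using cardV by simp
  finally show ?thesis .
qed

text \<open>Two vertices of \<open>A\<close> together miss at most \<open>10 * k + 2\<close>
  vertices of \<open>J\<close>, which leaves them \<open>k + 1\<close> common neighbours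
  there.\<close>

lemma side_degree:
  assumes "A \<inter> J = {}" "\<And>x. x \<in> A \<Longrightarrow> card (J - nbrs E x) \<le> 5 * k + 1" "11 * k + 3 \<le> card J"
    and "x \<in> A" "finite J"
  shows "card (nbrs E x \<inter> A) \<le> k"
proof (rule few_common_neighbours[OF finV EV free])
  show "nbrs E x \<inter> A \<subseteq> nbrs E x" by blast
  show "nbrs E x \<inter> A \<inter> J = {}" using assms(1) by blast
  fix d assume d: "d \<in> nbrs E x \<inter> A"
  have "J \<subseteq> (nbrs E x \<inter> nbrs E d \<inter> J) \<union> (J - nbrs E x) \<union> (J - nbrs E d)" by blast
  then have "card J \<le> card ((nbrs E x \<inter> nbrs E d \<inter> J) \<union> (J - nbrs E x) \<union> (J - nbrs E d))"
    using \<open>finite J\<close> by (intro card_mono) auto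
  also have "\<dots> \<le> card (nbrs E x \<inter> nbrs E d \<inter> J) + card (J - nbrs E x) + card (J - nbrs E d)"
    by (meson card_Un_le order_trans add_le_mono1)
  finally show "Suc k \<le> card (nbrs E x \<inter> nbrs E d \<inter> J)"
    using assms(2)[of x] assms(2)[of d] assms(3,4) d by simp
qed

text \<open>A neighbour of \<open>r\<close> in \<open>X\<close> misses at most
  \<open>2 * k + 1\<close> of the at least \<open>3 * k + 2\<close> neighbours of \<open>r\<close>
  in \<open>Y\<close>, which leaves \<open>k + 1\<close> common ones.\<close>

lemma one_sided_neighbours:
  assumes "X \<inter> Y = {}" "\<And>x. x \<in> X \<Longrightarrow> card (Y - nbrs E x) \<le> 2 * k + 1"
    and "3 * k + 2 \<le> card (nbrs E r \<inter> Y)" "finite Y"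
  shows "card (nbrs E r \<inter> X) \<le> k"
proof (rule few_common_neighbours[OF finV EV free])
  show "nbrs E r \<inter> X \<subseteq> nbrs E r" by blast
  show "nbrs E r \<inter> X \<inter> Y = {}" using assms(1) by blast
  fix d assume d: "d \<in> nbrs E r \<inter> X"
  have "nbrs E r \<inter> Y \<subseteq> (nbrs E r \<inter> nbrs E d \<inter> Y) \<union> (Y - nbrs E d)" by blast
  then have "card (nbrs E r \<inter> Y) \<le> card ((nbrs E r \<inter> nbrs E d \<inter> Y) \<union> (Y - nbrs E d))"
    using \<open>finite Y\<close> by (intro card_mono) auto
  also have "\<dots> \<le> card (nbrs E r \<inter> nbrs E d \<inter> Y) + card (Y - nbrs E d)"
    by (rule card_Un_le)
  finally show "Suc k \<le> card (nbrs E r \<inter> nbrs E d \<inter> Y)"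
    using assms(2)[of d] assms(3) d by simp
qed

text \<open>The cores of the two sides are independent sets \<open>I\<close> and \<open>J\<close>
  found inside neighbourhoods; \<open>J\<close> is taken at a vertex of \<open>I\<close> and is thus
  disjoint from \<open>I\<close>. At most \<open>4 * k + 1\<close> other vertices are distributed.
  Every inner edge has an end among them, and inner degrees are at most \<open>k\<close>. The bound
  on \<open>m\<close> makes both cores have at least \<open>11 * k + 3\<close> vertices.\<close>

lemma bipartition:
  assumes m: "26 * k + 6 \<le> m"
  obtains A B where "A \<union> B = V" "A \<inter> B = {}"
    "\<And>x. x \<in> A \<Longrightarrow> card (nbrs E x \<inter> A) \<le> k" "\<And>x. x \<in> B \<Longrightarrow> card (nbrs E x \<inter> B) \<le> k"
    "card {e \<in> E. e \<subseteq> A} + card {e \<in> E. e \<subseteq> B} \<le> (4 * k + 1) * k"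
    "m div 2 \<le> card A + 2 * k" "m div 2 \<le> card B + 2 * k"
proof -
  have "V \<noteq> {}" using m cardV by auto
  then obtain v where v: "v \<in> V" by blast
  obtain I where I: "I \<subseteq> nbrs E v" "card (nbrs E v) \<le> card I + 2 * k" "\<And>e. e \<in> E \<Longrightarrow> \<not> e \<subseteq> I"
    using independent_neighbours[OF finV EV free] by metis
  have cI: "m div 2 \<le> card I + 2 * k" using min_degree[OF v] I(2) by simp
  have IV: "I \<subseteq> V" using I(1) nbrs_subset[OF EV, of v] by blast
  have "card I \<noteq> 0" using cI m by linarith
  then obtain u where u: "u \<in> I" by fastforce
  obtain J where J: "J \<subseteq> nbrs E u" "card (nbrs E u) \<le> card J + 2 * k" "\<And>e. e \<in> E \<Longrightarrow> \<not> e \<subseteq> J"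
    using independent_neighbours[OF finV EV free] by metis
  have cJ: "m div 2 \<le> card J + 2 * k" using min_degree[of u] IV u J(2) by force
  have "nbrs E u \<subseteq> V - I" by (rule independent_missing(1)[OF IV I(3) u, of "{}"]) auto
  then have JVI: "J \<subseteq> V - I" using J(1) by blast
  then have JV: "J \<subseteq> V" and IJ: "I \<inter> J = {}" and IVJ: "I \<subseteq> V - J" using IV by auto
  have fin: "finite I" "finite J" using IV JV finV finite_subset by auto
  have missI: "card (J - nbrs E i) + card I + m div 2 \<le> m" if "i \<in> I" for i
    by (rule independent_missing(2)[OF IV I(3) that JVI])
  have missJ: "card (I - nbrs E j) + card J + m div 2 \<le> m" if "j \<in> J" for j
    by (rule independent_missing(2)[OF JV J(3) that IVJ])
  have "card J \<noteq> 0" using cJ m by linarith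
  then obtain w where w: "w \<in> J" by fastforce
  have leI: "card I + m div 2 \<le> m" and leJ: "card J + m div 2 \<le> m"
    using missI[OF u] missJ[OF w] by auto
  \<comment> \<open>Rounding costs one for odd \<open>m\<close>: this is the \<open>+ 1\<close> in
    \<open>2 * k + 1\<close>, \<open>4 * k + 1\<close> and \<open>5 * k + 1\<close> below.\<close>
  have m2: "m \<le> 2 * (m div 2) + 1" by presburger
  have missI': "card (J - nbrs E i) \<le> 2 * k + 1" if "i \<in> I" for i
    using missI[OF that] cI m2 by linarith
  have missJ': "card (I - nbrs E j) \<le> 2 * k + 1" if "j \<in> J" for j
    using missJ[OF that] cJ m2 by linarith
  define R where "R = V - I - J"
  have "card R + card J + card I = m"
  proof -
    have "card (V - I) = m - card I" using IV fin cardV by (simp add: card_Diff_subset)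
    moreover have "card R = card (V - I) - card J"
      unfolding R_def using JVI fin by (intro card_Diff_subset)
    moreover have "card J \<le> card (V - I)" using JVI finV by (intro card_mono) auto
    moreover have "card I \<le> m" using IV finV cardV card_mono by blast
    ultimately show ?thesis by linarith
  qed
  then have cR: "card R \<le> 4 * k + 1" using cI cJ m2 by linarith
  have finR: "finite R" using finV by (simp add: R_def)
  have nR: "m div 2 \<le> card (nbrs E r \<inter> I) + card (nbrs E r \<inter> J) + 4 * k" if r: "r \<in> R" for r
  proof -
    have "nbrs E r \<subseteq> (nbrs E r \<inter> I) \<union> (nbrs E r \<inter> J) \<union> (R - {r})"
      using nbrs_subset[OF EV, of r] by (auto simp: R_def)
    then have "card (nbrs E r) \<le> card ((nbrs E r \<inter> I) \<union> (nbrs E r \<inter> J) \<union> (R - {r}))"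
      using fin finR by (intro card_mono) auto
    also have "\<dots> \<le> card (nbrs E r \<inter> I) + card (nbrs E r \<inter> J) + card (R - {r})"
      by (meson card_Un_le order_trans add_le_mono1)
    also have "card (R - {r}) \<le> 4 * k" using cR r finR by simp
    finally show ?thesis using min_degree[of r] r by (auto simp: R_def)
  qed
  define A where "A = I \<union> {r \<in> R. card (nbrs E r \<inter> I) \<le> k}"
  define B where "B = J \<union> {r \<in> R. \<not> card (nbrs E r \<inter> I) \<le> k}"
  have AB: "A \<union> B = V" "A \<inter> B = {}"
    using IV JV IJ by (auto simp: A_def B_def R_def)
  \<comment> \<open>Up to \<open>4 * k\<close> neighbours in \<open>R\<close> and \<open>k\<close>
    in \<open>I\<close> leave at least \<open>m div 2 - 5 * k\<close> neighbours in
    \<open>J\<close>, while \<open>J\<close> has at most \<open>m div 2 + 1\<close>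
    vertices.\<close>
  have missA: "card (J - nbrs E x) \<le> 5 * k + 1" if x: "x \<in> A" for x
  proof (cases "x \<in> I")
    case True
    then show ?thesis using missI' by fastforce
  next
    case False
    then have "x \<in> R" "card (nbrs E x \<inter> I) \<le> k" using x by (auto simp: A_def)
    then have "m div 2 \<le> card (nbrs E x \<inter> J) + 5 * k" using nR[of x] by linarith
    moreover have "card J = card (nbrs E x \<inter> J) + card (J - nbrs E x)"
      using fin by (metis card_Int_Diff inf_commute)
    ultimately show ?thesis using leJ m2 by linarith
  qed
  have missB: "card (I - nbrs E x) \<le> 5 * k + 1" if x: "x \<in> B" for x
  proof (cases "x \<in> J")
    case True
    then show ?thesis using missJ' by fastforce
  next
    case False
    then have xR: "x \<in> R" "\<not> card (nbrs E x \<inter> I) \<le> k" using x by (auto simp: B_def)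
    \<comment> \<open>With \<open>3 * k + 2\<close> neighbours in \<open>J\<close> there could be at
      most \<open>k\<close> in \<open>I\<close>. So the degree forces many neighbours in
      \<open>I\<close>, and the same argument with the cores exchanged leaves at most
      \<open>k\<close> in \<open>J\<close>.\<close>
    then have "\<not> 3 * k + 2 \<le> card (nbrs E x \<inter> J)"
      using one_sided_neighbours[OF IJ missI' _ fin(2)] by blast
    then have "3 * k + 2 \<le> card (nbrs E x \<inter> I)"
      using nR[OF xR(1)] m by linarith
    moreover have "J \<inter> I = {}" using IJ by blast
    ultimately have "card (nbrs E x \<inter> J) \<le> k"
      using one_sided_neighbours[OF _ missJ' _ fin(1)] by blast
    then have "m div 2 \<le> card (nbrs E x \<inter> I) + 5 * k" using nR[OF xR(1)] by linarith
    moreover have "card I = card (nbrs E x \<inter> I) + card (I - nbrs E x)"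
      using fin by (metis card_Int_Diff inf_commute)
    ultimately show ?thesis using leI m2 by linarith
  qed
  have degA: "card (nbrs E x \<inter> A) \<le> k" if "x \<in> A" for x
  proof (rule side_degree[OF _ missA _ that fin(2)])
    show "A \<inter> J = {}" using AB by (auto simp: B_def)
    show "11 * k + 3 \<le> card J" using cJ m by linarith
  qed
  have degB: "card (nbrs E x \<inter> B) \<le> k" if "x \<in> B" for x
  proof (rule side_degree[OF _ missB _ that fin(1)])
    show "B \<inter> I = {}" using AB by (auto simp: A_def)
    show "11 * k + 3 \<le> card I" using cI m by linarith
  qed
  have "card (A - I) + card (B - J) \<le> card R"
  proof -
    have "card (A - I) + card (B - J) = card ((A - I) \<union> (B - J))"
      using AB finV by (intro card_Un_disjoint[symmetric]) (auto intro: finite_subset[of _ V])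
    also have "\<dots> \<le> card R"
      using finR by (intro card_mono) (auto simp: A_def B_def)
    finally show ?thesis .
  qed
  then have "(card (A - I) + card (B - J)) * k \<le> (4 * k + 1) * k"
    using cR by (intro mult_le_mono1) linarith
  moreover have "card {e \<in> E. e \<subseteq> A} \<le> card (A - I) * k"
    using card_inside_edges_le[OF finV EV _ I(3) degA] AB by auto
  moreover have "card {e \<in> E. e \<subseteq> B} \<le> card (B - J) * k"
    using card_inside_edges_le[OF finV EV _ J(3) degB] AB by auto
  ultimately have "card {e \<in> E. e \<subseteq> A} + card {e \<in> E. e \<subseteq> B} \<le> (4 * k + 1) * k"
    by (simp add: algebra_simps)
  moreover have "card I \<le> card A" "card J \<le> card B"
    using AB finV by (intro card_mono; auto simp: A_def B_def intro: finite_subset[of _ V])+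
  ultimately show thesis
    using that[OF AB degA degB] cI cJ by linarith
qed

end

section \<open>Coloured bipartitions\<close>

text \<open>The weighted bound needs \<open>k - 1 + D\<close> per deleted vertex and \<open>2 * (D + 1)\<close> per matching edge of an
  odd class, where \<open>D = k - 1 - b\<close>; for \<open>k = 3\<close> and \<open>b = 1\<close> the parity of \<open>D = 1\<close> saves one.\<close>

definition class_weight :: "nat \<Rightarrow> nat \<Rightarrow> nat" where
  "class_weight k b = (if k = 3 \<and> b = 1 then 3 else max (2 * (k - 1) - b) (2 * (k - b)))"

text \<open>These are the three conditions on \<open>K\<close> in \<open>weighted_edge_bound\<close>
  for \<open>p = k - 1\<close> and \<open>D = k - 1 - b\<close>.\<close>

lemma class_weight_ge:
  assumes "b + 2 \<le> k"
  shows "(k - 1) + (k - 1 - b) \<le> class_weight k b" "2 * (k - 1 - b) \<le> class_weight k b"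
    "(2 * n + 1) * min (k - 1 - b) (2 * n) \<le> n * class_weight k b"
proof -
  show "(k - 1) + (k - 1 - b) \<le> class_weight k b" "2 * (k - 1 - b) \<le> class_weight k b"
    using assms by (auto simp: class_weight_def)
  define D where "D = k - 1 - b"
  show "(2 * n + 1) * min (k - 1 - b) (2 * n) \<le> n * class_weight k b"
  proof (cases "k = 3 \<and> b = 1")
    case True
    \<comment> \<open>Here \<open>D = 1\<close>, and \<open>2 * n + 1 \<le> 3 * n\<close> for
      \<open>n \<ge> 1\<close>.\<close>
    then show ?thesis by (cases n) (auto simp: class_weight_def)
  next
    case False
    then have "2 * (k - b) \<le> class_weight k b" unfolding class_weight_def by simp
    moreover have "2 * (D + 1) = 2 * (k - b)" using assms by (simp add: D_def)
    ultimately have K: "2 * (D + 1) \<le> class_weight k b" by simp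
    have "(2 * n + 1) * min D (2 * n) \<le> n * (2 * (D + 1))"
    proof (cases "D \<le> 2 * n")
      case True
      then show ?thesis by (simp add: algebra_simps)
    next
      case False
      then have "(2 * n + 1) * (2 * n) \<le> D * (2 * n)" by (intro mult_right_mono) auto
      then show ?thesis using False by (simp add: algebra_simps)
    qed
    also have "\<dots> \<le> n * class_weight k b" using K by (rule mult_le_mono2)
    finally show ?thesis by (simp add: D_def)
  qed
qed

text \<open>By symmetry \<open>b \<le> a\<close>. When both numbers are at least \<open>2\<close> an
  exact product identity settles the claim; small values are treated separately.\<close>

lemma class_weight_less:
  assumes "a + 2 \<le> k" "b + 2 \<le> k"
  shows "class_weight k b * a + class_weight k a * b < 2 * (k - 1)\<^sup>2"
proof -
  have *: "class_weight k b * a + class_weight k a * b < 2 * (k - 1)\<^sup>2"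
    if ab: "a + 2 \<le> k" "b + 2 \<le> k" "b \<le> a" for a b
  proof -
    define j where "j = k - 2"
    have j: "k = j + 2" using ab by (simp add: j_def)
    have aj: "a \<le> j" "b \<le> j" using ab j by auto
    consider "b = 0" | "a = 1" "b = 1" | "a \<ge> 2" "b = 1" | "a \<ge> 2" "b \<ge> 2" using ab(3) by linarith
    then show ?thesis
    proof cases
      case 1
      have "class_weight k 0 * a \<le> (2 * (j + 2)) * j"
        unfolding class_weight_def using aj j by (intro mult_le_mono) auto
      also have "\<dots> < 2 * (j + 1)\<^sup>2" by (simp add: power2_eq_square algebra_simps)
      finally show ?thesis using 1 j by simp
    next
      case 2
      show ?thesis
      \<comment> \<open>For \<open>k = 3\<close> and \<open>a = b = 1\<close> the general formula
        would give the weight \<open>4\<close> and hence equality, \<open>8\<close> on both sides;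
        the special value \<open>3\<close> makes the inequality strict.\<close>
      proof (cases "j = 1")
        case True
        then show ?thesis using 2 j by (simp add: class_weight_def power2_eq_square)
      next
        case False
        define i where "i = j - 2"
        have "j = i + 2" using False 2 aj by (simp add: i_def)
        then show ?thesis using 2 j by (simp add: class_weight_def power2_eq_square algebra_simps)
      qed
    next
      case 3
      have "class_weight k b = 2 * j + 2" "class_weight k a = 2 * j + 2 - a"
        using 3 aj j by (auto simp: class_weight_def)
      then have "class_weight k b * a + class_weight k a * b = (2 * j + 2) * a + (2 * j + 2 - a)"
        using 3 by simp
      also have "\<dots> = (2 * j + 1) * a + (2 * j + 2)" using aj by (simp add: algebra_simps)
      also have "\<dots> \<le> (2 * j + 1) * j + (2 * j + 2)" using aj by (intro add_right_mono mult_le_mono2)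
      also have "\<dots> < 2 * (j + 1)\<^sup>2" using 3 aj by (simp add: power2_eq_square algebra_simps)
      finally show ?thesis using j by simp
    next
      case 4
      have "class_weight k b = 2 * j + 2 - b" "class_weight k a = 2 * j + 2 - a"
        using 4 aj j by (auto simp: class_weight_def)
      then have "int (class_weight k b * a + class_weight k a * b)
          = (2 + 2 * int j - int b) * int a + (2 + 2 * int j - int a) * int b"
        using aj by (simp add: of_nat_diff)
      \<comment> \<open>The gap to \<open>2 * (k - 1)\<^sup>2\<close> is twice the product of
        \<open>k - 1 - a\<close> and \<open>k - 1 - b\<close>, both positive.\<close>
      also have "\<dots> = 2 * (int j + 1)\<^sup>2 - 2 * ((int j + 1 - int a) * (int j + 1 - int b))"
        by (simp add: power2_eq_square algebra_simps)
      also have "\<dots> < 2 * (int j + 1)\<^sup>2"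
        using aj by (simp add: mult_pos_pos)
      also have "\<dots> = int (2 * (k - 1)\<^sup>2)" using j by simp
      finally show ?thesis by (simp only: of_nat_less_iff)
    qed
  qed
  show ?thesis
    using *[of a b] *[of b a] assms by (cases "b \<le> a") (auto simp: add.commute)
qed

section \<open>Counting edges in a bipartition\<close>

definition missing :: "'a set \<Rightarrow> 'a set \<Rightarrow> 'a set set \<Rightarrow> ('a \<times> 'a) set" where
  "missing A B E = (SIGMA x:A. B - nbrs E x)"

lemma card_missing: "finite A \<Longrightarrow> finite B \<Longrightarrow> card (missing A B E) = (\<Sum>x\<in>A. card (B - nbrs E x))"
  by (simp add: missing_def)

lemma card_missing_swap: "card (missing A B E) = card (missing B A E)"
proof (rule bij_betw_same_card[of prod.swap], rule bij_betwI[of _ _ _ prod.swap])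
  show "prod.swap \<in> missing A B E \<rightarrow> missing B A E" "prod.swap \<in> missing B A E \<rightarrow> missing A B E"
    by (auto simp: missing_def nbrs_sym)
qed auto

lemma card_edges_bipartition:
  assumes V: "finite V" "E \<subseteq> [V]\<^bsup>2\<^esup>" and AB: "A \<union> B = V" "A \<inter> B = {}"
  shows "card E + card (missing A B E) = card {e \<in> E. e \<subseteq> A} + card {e \<in> E. e \<subseteq> B} + card A * card B"
proof -
  let ?C = "SIGMA x:A. B \<inter> nbrs E x"
  let ?f = "\<lambda>(x, y). {x, y}"
  have fin: "finite A" "finite B" "finite E" using finite_edges[OF V] V(1) AB(1) by auto
  have E: "E = ({e \<in> E. e \<subseteq> A} \<union> {e \<in> E. e \<subseteq> B}) \<union> ?f ` ?C"
  proof (intro equalityI subsetI)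
    fix e assume e: "e \<in> E"
    then have "e \<in> [V]\<^bsup>2\<^esup>" using V by blast
    then obtain x y where xy: "e = {x, y}" "x \<in> V" "y \<in> V" by (rule nsets2_E)
    consider "x \<in> A" "y \<in> A" | "x \<in> B" "y \<in> B" | "x \<in> A" "y \<in> B" | "x \<in> B" "y \<in> A"
      using xy AB by blast
    then show "e \<in> ({e \<in> E. e \<subseteq> A} \<union> {e \<in> E. e \<subseteq> B}) \<union> ?f ` ?C"
    proof cases
      case 3
      then have "(x, y) \<in> ?C" using xy e by (auto simp: nbrs_def)
      then show ?thesis using xy by (auto simp: image_iff)
    next
      case 4
      then have "(y, x) \<in> ?C" using xy e by (auto simp: nbrs_def insert_commute)
      moreover have "e = ?f (y, x)" using xy by auto
      ultimately show ?thesis by blast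
    qed (use e xy in auto)
  qed (auto simp: nbrs_def)
  have inj: "inj_on ?f ?C" using AB(2) by (auto simp: inj_on_def doubleton_eq_iff)
  have disj1: "{e \<in> E. e \<subseteq> A} \<inter> {e \<in> E. e \<subseteq> B} = {}"
  proof -
    have "e \<noteq> {}" if "e \<in> E" for e using that V by (auto simp: nsets_def)
    then show ?thesis using AB(2) by blast
  qed
  have disj2: "({e \<in> E. e \<subseteq> A} \<union> {e \<in> E. e \<subseteq> B}) \<inter> ?f ` ?C = {}" using AB(2) by auto
  have "card E = card (({e \<in> E. e \<subseteq> A} \<union> {e \<in> E. e \<subseteq> B}) \<union> ?f ` ?C)" using E by simp
  also have "\<dots> = card ({e \<in> E. e \<subseteq> A} \<union> {e \<in> E. e \<subseteq> B}) + card (?f ` ?C)"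
    using disj2 fin by (intro card_Un_disjoint) auto
  also have "card ({e \<in> E. e \<subseteq> A} \<union> {e \<in> E. e \<subseteq> B}) = card {e \<in> E. e \<subseteq> A} + card {e \<in> E. e \<subseteq> B}"
    using disj1 fin by (intro card_Un_disjoint) auto
  also have "card (?f ` ?C) = card ?C" by (rule card_image[OF inj])
  finally have cE: "card E = card {e \<in> E. e \<subseteq> A} + card {e \<in> E. e \<subseteq> B} + card ?C" .
  have "card A * card B = card (?C \<union> missing A B E)"
  proof -
    have "A \<times> B = ?C \<union> missing A B E" by (auto simp: missing_def)
    then show ?thesis by (metis card_cartesian_product)
  qed
  also have "\<dots> = card ?C + card (missing A B E)"
    using fin by (intro card_Un_disjoint) (auto simp: missing_def)
  finally show ?thesis using cE by simp
qed

section \<open>Clean vertices and twin pairs\<close>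

lemma disjoint_pairs:
  assumes "2 * N \<le> card S"
  obtains Q where "Q \<subseteq> [S]\<^bsup>2\<^esup>" "pairwise disjnt Q" "card Q = N" "finite Q"
proof -
  have "\<exists>Q \<subseteq> [S]\<^bsup>2\<^esup>. pairwise disjnt Q \<and> card Q = N \<and> finite Q" if "2 * N \<le> card S"
    using that
  proof (induction N)
    case 0
    show ?case by (intro exI[of _ "{}"]) auto
  next
    case (Suc N)
    then obtain Q where Q: "Q \<subseteq> [S]\<^bsup>2\<^esup>" "pairwise disjnt Q" "card Q = N" "finite Q" by auto
    have "card (\<Union>Q) \<le> 2 * N" using card_Union_edges_le[OF Q(1)] Q(3) by simp
    moreover have "\<Union>Q \<subseteq> S" using Q(1) by (auto simp: nsets_def)
    moreover have "finite (\<Union>Q)" using Q(1,4) by (auto simp: nsets_def)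
    ultimately have "2 \<le> card (S - \<Union>Q)"
      using Suc.prems by (simp add: card_Diff_subset)
    then obtain T where T: "T \<subseteq> S - \<Union>Q" "card T = 2" "finite T"
      by (rule obtain_subset_with_card_n)
    have "T \<notin> Q"
    proof
      assume "T \<in> Q"
      then have "T = {}" using T(1) by blast
      then show False using T(2) by simp
    qed
    moreover have "insert T Q \<subseteq> [S]\<^bsup>2\<^esup>" using T Q(1) by (auto simp: nsets_def)
    moreover have "pairwise disjnt (insert T Q)"
      using T(1) Q(2) by (auto simp: pairwise_insert disjnt_def)
    ultimately show ?case using Q(3,4) by (intro exI[of _ "insert T Q"]) auto
  qed
  with assms that show thesis by blast
qed

text \<open>The edge \<open>p\<close> may stand in for \<open>g\<close>, whose colour is free
  because \<open>F\<close> leaves \<open>g\<close> out.\<close>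

lemma inj_on_insert_recoloured:
  assumes "inj_on c E" "g \<in> E" "F \<subseteq> E - {g}" "c p = c g"
  shows "inj_on c (insert p F)"
proof -
  have "inj_on c F" using assms(1,3) by (auto intro: inj_on_subset)
  moreover have "c p \<notin> c ` F"
  proof
    assume "c p \<in> c ` F"
    then obtain f where "f \<in> F" "c g = c f" using assms(4) by auto
    then show False using assms(1,2,3) by (auto simp: inj_on_def)
  qed
  ultimately show ?thesis by auto
qed

text \<open>In the application \<open>g\<close> is the edge of \<open>E\<close> with the colour of
  the pairs, given up when one of them is used. Two pairs are kept because \<open>g\<close> may get
  in the way of one, for instance as a spoke.\<close>

definition twin_pairs :: "('a set \<Rightarrow> 'c) \<Rightarrow> 'a set \<Rightarrow> 'a set \<Rightarrow> 'a set \<Rightarrow> 'a set \<Rightarrow> bool" where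
  "twin_pairs c S P P' g \<longleftrightarrow> P \<in> [S]\<^bsup>2\<^esup> \<and> P' \<in> [S]\<^bsup>2\<^esup> \<and> P \<inter> P' = {} \<and> c P = c g \<and> c P' = c g"

text \<open>\<open>E\<close> contains exactly one edge of each colour on \<open>V\<close>, and
  \<open>A0\<close>, \<open>B0\<close> are sets of clean vertices. The assumptions are symmetric in
  the two sides, so each result is also available with the sides exchanged.\<close>

locale coloured_bipartition =
  fixes c :: "'a set \<Rightarrow> 'c" and V A B A0 B0 :: "'a set" and E :: "'a set set" and k :: nat
  assumes finV: "finite V" and EV: "E \<subseteq> [V]\<^bsup>2\<^esup>"
    and inj: "inj_on c E" and colours: "c ` [V]\<^bsup>2\<^esup> = c ` E"
    and AB: "A \<union> B = V" "A \<inter> B = {}"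
    and A0: "A0 \<subseteq> A" "\<And>x. x \<in> A0 \<Longrightarrow> B \<subseteq> nbrs E x" "\<And>x. x \<in> A0 \<Longrightarrow> nbrs E x \<inter> A = {}"
    and B0: "B0 \<subseteq> B" "\<And>x. x \<in> B0 \<Longrightarrow> A \<subseteq> nbrs E x" "\<And>x. x \<in> B0 \<Longrightarrow> nbrs E x \<inter> B = {}"
    and degA: "\<And>x. x \<in> A \<Longrightarrow> card (nbrs E x \<inter> A) \<le> k"
    and degB: "\<And>x. x \<in> B \<Longrightarrow> card (nbrs E x \<inter> B) \<le> k"
    and sizeA: "2 * k + 12 \<le> card A0" and sizeB: "2 * k + 12 \<le> card B0"
    and no_rainbow: "\<And>x M. rainbow_fan c V x M \<Longrightarrow> card M \<le> k"
begin

lemma swap: "coloured_bipartition c V B A B0 A0 E k"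
  by unfold_locales
    (use finV EV inj colours AB A0 B0 degA degB sizeA sizeB no_rainbow in auto)

lemma fin: "finite A" "finite B" "finite A0" "finite B0" "finite E"
  using finite_edges[OF finV EV] finV AB(1) A0(1) B0(1) by (auto intro: finite_subset)

lemma finN: "finite (nbrs E x)"
  using finite_nbrs[OF finV EV] .

lemma edge_card: "e \<in> E \<Longrightarrow> card e = 2" "e \<in> E \<Longrightarrow> finite e"
  using EV by (auto simp: nsets_def)

lemma clean_not_in_inner_edge:
  assumes "e \<in> E" "e \<subseteq> B"
  shows "e \<inter> B0 = {}"
proof (rule ccontr)
  assume "e \<inter> B0 \<noteq> {}"
  then obtain u where u: "u \<in> e" "u \<in> B0" by blast
  have "e \<in> [V]\<^bsup>2\<^esup>" using assms EV by blast
  then obtain w where "e = {u, w}" using u(1) by (rule edge_other_end)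
  then have "w \<in> nbrs E u \<inter> B" using assms by (auto simp: nbrs_def)
  then show False using B0(3)[OF u(2)] by blast
qed

text \<open>An edge with both ends in \<open>B0\<close> would be an inner edge at a clean
  vertex.\<close>

lemma edge_clean_card: "g \<in> E \<Longrightarrow> card (g \<inter> B0) \<le> 1"
proof -
  assume g: "g \<in> E"
  show ?thesis
  proof (rule ccontr)
    assume "\<not> card (g \<inter> B0) \<le> 1"
    moreover have "card (g \<inter> B0) \<le> card g" using edge_card[OF g] by (intro card_mono) auto
    ultimately have "card (g \<inter> B0) = card g" using edge_card[OF g] by linarith
    then have "g \<inter> B0 = g" using edge_card[OF g] by (intro card_subset_eq) auto
    then have "g \<subseteq> B0" by blast
    then have "g \<inter> B0 = {}" using clean_not_in_inner_edge[OF g] B0(1) by blast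
    then show False using \<open>g \<inter> B0 = g\<close> edge_card(1)[OF g] by auto
  qed
qed

text \<open>If \<open>k + 1\<close> disjoint pairs in \<open>B0\<close> had distinct colours, they
  would form a rainbow fan around a suitable vertex of \<open>A0\<close>; so two of them share a
  colour.\<close>

lemma twin_pairs_exist:
  obtains P P' g where "twin_pairs c B0 P P' g" "g \<in> E"
proof -
  have "2 * (k + 1) \<le> card B0" using sizeB by simp
  then obtain Q where Q: "Q \<subseteq> [B0]\<^bsup>2\<^esup>" "pairwise disjnt Q" "card Q = k + 1" "finite Q"
    by (rule disjoint_pairs)
  have QV: "Q \<subseteq> [V]\<^bsup>2\<^esup>" using Q(1) B0(1) AB by (auto simp: nsets_def)
  have "\<exists>g\<in>E. c P = c g" if "P \<in> Q" for P
    using colours QV that by (metis imageE imageI subsetD)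
  then obtain g where g: "\<And>P. P \<in> Q \<Longrightarrow> g P \<in> E \<and> c P = c (g P)" by metis
  have "\<not> inj_on c Q"
  proof
    assume injQ: "inj_on c Q"
    have "card (\<Union>(g ` Q)) \<le> 2 * (k + 1)"
    proof -
      have "card (\<Union>(g ` Q)) \<le> 2 * card (g ` Q)"
        using g EV by (intro card_Union_edges_le[of _ V]) auto
      also have "card (g ` Q) \<le> k + 1" using card_image_le[OF Q(4), of g] Q(3) by simp
      finally show ?thesis by simp
    qed
    \<comment> \<open>The centre is a clean vertex off all representatives \<open>g P\<close>. A
      spoke with the colour of \<open>P\<close> would have to be \<open>g P\<close> itself, so no
      spoke repeats the colour of a pair.\<close>
    then have "\<not> A0 \<subseteq> \<Union>(g ` Q)"
      using sizeA card_mono[of "\<Union>(g ` Q)" A0] g edge_card(2) Q(4) by fastforce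
    then obtain x where x: "x \<in> A0" "x \<notin> \<Union>(g ` Q)" by blast
    have QB: "\<Union>Q \<subseteq> B" using Q(1) B0(1) by (auto simp: nsets_def)
    have xB: "x \<notin> B" using x(1) A0(1) AB by blast
    have fan: "fan x Q"
      unfolding fan_def using Q xB QB by (auto simp: nsets_def)
    have spokes: "{x, u} \<in> E" if "u \<in> \<Union>Q" for u
      using A0(2)[OF x(1)] QB that by (auto simp: nbrs_def)
    have "fan_edges x Q \<subseteq> [V]\<^bsup>2\<^esup>" unfolding fan_edges_def using QV spokes EV by blast
    moreover have "inj_on c (fan_edges x Q)"
      unfolding fan_edges_def
    proof (rule inj_on_Un[THEN iffD2], intro conjI)
      show "inj_on c ((\<lambda>u. {x, u}) ` \<Union>Q)"
        using spokes by (intro inj_on_subset[OF inj]) auto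
      have False if P: "P \<in> Q" "u \<in> \<Union>Q" "c P = c {x, u}" for P u
      proof -
        have "g P = {x, u}"
          using inj g[OF P(1)] spokes[OF P(2)] P(3) by (auto simp: inj_on_def)
        then show False using x(2) P(1) by blast
      qed
      then show "c ` (Q - (\<lambda>u. {x, u}) ` \<Union>Q) \<inter> c ` ((\<lambda>u. {x, u}) ` \<Union>Q - Q) = {}" by blast
    qed (rule injQ)
    ultimately have "card Q \<le> k" using fan no_rainbow by (auto simp: rainbow_fan_def)
    then show False using Q(3) by simp
  qed
  then obtain P P' where PP: "P \<in> Q" "P' \<in> Q" "c P = c P'" "P \<noteq> P'" by (auto simp: inj_on_def)
  then have "P \<inter> P' = {}" using Q(2) by (auto simp: pairwise_def disjnt_def)
  then have "twin_pairs c B0 P P' (g P)"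
    using PP Q(1) g[OF PP(1)] by (auto simp: twin_pairs_def)
  then show thesis using that g[OF PP(1)] by blast
qed

text \<open>Centred at \<open>x\<close> there are the triangles over \<open>M\<close>, one triangle
  for each neighbour of \<open>x\<close> in \<open>A\<close>, completed by its own clean vertex of
  \<open>B\<close>, and one more over a twin pair, which carries the colour of the deleted edge
  \<open>g0\<close>. They form a rainbow fan, so there are at most \<open>k\<close> of them.\<close>

lemma degree_plus_matching_less:
  assumes P: "twin_pairs c B0 P P' g0" "g0 \<in> E" and g1: "g1 \<in> E"
    and E1: "E1 = E - {g0, g1}" and x: "x \<in> A"
    and M: "matching E1 M" "\<Union>M \<subseteq> B \<inter> nbrs E1 x"
  shows "card (nbrs E1 x \<inter> A) + card M < k"
proof -
  define D where "D = nbrs E1 x \<inter> A"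
  have N1: "nbrs E1 x \<subseteq> nbrs E x" by (auto simp: nbrs_def E1)
  then have "D \<subseteq> nbrs E x \<inter> A" by (auto simp: D_def)
  then have D: "finite D" "card D \<le> k"
    using finN[of x] degA[OF x] card_mono[of "nbrs E x \<inter> A" D]
    by (auto intro: finite_subset)
  have P2: "P \<subseteq> B0" "P' \<subseteq> B0" "card P = 2" "card P' = 2" "P \<inter> P' = {}" "c P = c g0" "c P' = c g0"
      "finite P" "finite P'"
    using P(1) by (auto simp: twin_pairs_def nsets_def)
  \<comment> \<open>\<open>Z\<close> supplies the third vertices of the triangles over
    \<open>D\<close>. At most \<open>8\<close> vertices are excluded: those of the two pairs and of
    \<open>g0\<close> and \<open>g1\<close>.\<close>
  define Z where "Z = B0 - (P \<union> P' \<union> g0 \<union> g1)"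
  have "card (P \<union> P' \<union> g0 \<union> g1) \<le> card P + card P' + card g0 + card g1"
    by (meson card_Un_le order_trans add_le_mono1)
  then have "card (P \<union> P' \<union> g0 \<union> g1) \<le> 8"
    using P2(3,4) edge_card(1)[OF P(2)] edge_card(1)[OF g1] by simp
  moreover have "card B0 - card (P \<union> P' \<union> g0 \<union> g1) \<le> card Z"
    unfolding Z_def using P2 edge_card(2)[OF P(2)] edge_card(2)[OF g1] by (intro diff_card_le_card_Diff) auto
  ultimately have "card D \<le> card Z" using D(2) sizeB by linarith
  then obtain f where f: "f ` D \<subseteq> Z" "inj_on f D"
    using card_le_inj[of D Z] D(1) fin by (auto simp: Z_def)
  have ZB: "Z \<subseteq> B0" "Z \<inter> g0 = {}" "Z \<inter> g1 = {}" "Z \<inter> P = {}" "Z \<inter> P' = {}" by (auto simp: Z_def)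
  have clean: "{b, a} \<in> E" if "b \<in> B0" "a \<in> A" for a b
    using B0(2)[OF that(1)] that(2) by (auto simp: nbrs_def)
  have MB0: "\<Union>M \<inter> B0 = {}"
  proof -
    have "e \<inter> B0 = {}" if "e \<in> M" for e
      using that M by (intro clean_not_in_inner_edge) (auto simp: matching_def E1)
    then show ?thesis by blast
  qed
  have ME: "M \<subseteq> E1" and E1E: "E1 \<subseteq> E" using M(1) by (auto simp: matching_def E1)
  have xN: "x \<notin> nbrs E x" using nbrs_subset[OF EV, of x] by blast
  have xB: "x \<notin> B" using x AB(2) by blast
  have fanM: "fan x M"
    unfolding fan_def
  proof (intro conjI ballI)
    show "finite M" using ME E1E fin(5) by (meson finite_subset)
    show "card e = 2" if "e \<in> M" for e using that ME E1E edge_card(1) by blast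
    show "pairwise disjnt M" using M(1) by (simp add: matching_def)
    show "x \<notin> \<Union>M" using M(2) xB by blast
  qed
  let ?M = "M \<union> (\<lambda>d. {d, f d}) ` D"
  have fD: "f ` D \<subseteq> B" "f ` D \<subseteq> B0" using f(1) ZB(1) B0(1) by auto
  have DA: "D \<subseteq> A" by (simp add: D_def)
  have M1: "fan x ?M \<and> card ?M = card M + card D"
  proof (rule fan_add_triangles[OF D(1) fanM f(2)])
    show "x \<notin> D" using xN N1 by (auto simp: D_def)
    show "x \<notin> f ` D" using fD xB by blast
    show "D \<inter> f ` D = {}" using fD DA AB(2) by blast
    have "D \<inter> \<Union>M = {}" using DA M(2) AB(2) by blast
    moreover have "f ` D \<inter> \<Union>M = {}" using fD MB0 by blast
    ultimately show "(D \<union> f ` D) \<inter> \<Union>M = {}" by blast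
  qed
  have M1E: "fan_edges x ?M \<subseteq> E1"
  proof -
    have "{{d, f d}, {x, d}, {x, f d}} \<subseteq> E1" if d: "d \<in> D" for d
    proof -
      have "f d \<in> Z" using f(1) d by blast
      then have fd: "f d \<in> B0" "f d \<notin> g0" "f d \<notin> g1" using ZB by auto
      then have "{f d, d} \<in> E" "{f d, x} \<in> E" using clean DA d x by auto
      then have "{f d, d} \<in> E1" "{f d, x} \<in> E1" using fd by (auto simp: E1)
      moreover have "{x, d} \<in> E1" using d by (simp add: D_def nbrs_def)
      ultimately show ?thesis by (simp add: insert_commute)
    qed
    moreover have "fan_edges x M \<subseteq> E1"
    proof -
      have "{x, u} \<in> E1" if "u \<in> \<Union>M" for u using M(2) that by (auto simp: nbrs_def)
      then show ?thesis using ME unfolding fan_edges_def by blast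
    qed
    ultimately show ?thesis unfolding fan_edges_add_triangles by blast
  qed
  \<comment> \<open>\<open>g0\<close> can join \<open>x\<close> to only one of the disjoint pairs;
    the other pair closes the additional triangle.\<close>
  have "(\<forall>p\<in>P. {x, p} \<noteq> g0) \<or> (\<forall>p\<in>P'. {x, p} \<noteq> g0)"
  proof (rule ccontr)
    assume "\<not> ?thesis"
    then obtain p p' where "p \<in> P" "p' \<in> P'" "{x, p} = {x, p'}" by metis
    then have "p = p'" by (auto simp: doubleton_eq_iff)
    then show False using \<open>p \<in> P\<close> \<open>p' \<in> P'\<close> P2(5) by blast
  qed
  then obtain S where S: "S \<subseteq> B0" "card S = 2" "c S = c g0" "Z \<inter> S = {}" "\<forall>p\<in>S. {x, p} \<noteq> g0"
    using P2 ZB by metis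
  obtain p q where pq: "S = {p, q}" "p \<noteq> q" using S(2) by (auto simp: card_2_iff)
  have out: "u \<notin> \<Union>?M" "u \<noteq> x" if "u \<in> S" for u
  proof -
    have "u \<in> B0" "u \<in> B" using that S(1) B0(1) by auto
    then show "u \<noteq> x" using xB by blast
    have "u \<notin> D" using DA AB(2) \<open>u \<in> B\<close> by blast
    moreover have "u \<notin> f ` D" using f(1) S(4) that by blast
    moreover have "u \<notin> \<Union>M" using MB0 \<open>u \<in> B0\<close> by blast
    ultimately show "u \<notin> \<Union>?M" by auto
  qed
  let ?N = "insert {p, q} ?M"
  have fanN: "fan x ?N"
    by (rule fan_insert[OF M1[THEN conjunct1]]) (use pq out[of p] out[of q] in auto)
  have edgesN: "fan_edges x ?N = insert {p, q} ({{x, p}, {x, q}} \<union> fan_edges x ?M)"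
    unfolding fan_edges_insert by blast
  \<comment> \<open>Only the colour of \<open>g0\<close> is taken by \<open>{p, q}\<close>; a spoke
    to the pair may be \<open>g1\<close>, so the inclusion is in \<open>E - {g0}\<close> instead of
    \<open>E1\<close>.\<close>
  have F: "{{x, p}, {x, q}} \<union> fan_edges x ?M \<subseteq> E - {g0}"
  proof -
    have "{p, x} \<in> E" "{q, x} \<in> E" using S(1) pq(1) clean x by auto
    then have "{x, p} \<in> E - {g0}" "{x, q} \<in> E - {g0}" using S(5) pq(1) by (auto simp: insert_commute)
    moreover have "E1 \<subseteq> E - {g0}" by (auto simp: E1)
    ultimately show ?thesis using M1E by blast
  qed
  have injN: "inj_on c (insert {p, q} ({{x, p}, {x, q}} \<union> fan_edges x ?M))"
    using S(3) pq(1) by (intro inj_on_insert_recoloured[OF inj P(2) F]) simp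
  have "{p, q} \<in> [V]\<^bsup>2\<^esup>" using S(1) pq B0(1) AB(1) by auto
  moreover have "{{x, p}, {x, q}} \<union> fan_edges x ?M \<subseteq> [V]\<^bsup>2\<^esup>"
    using F EV by (meson Diff_subset subset_trans)
  ultimately have "fan_edges x ?N \<subseteq> [V]\<^bsup>2\<^esup>" unfolding edgesN by (rule insert_subsetI)
  then have "rainbow_fan c V x ?N"
    unfolding rainbow_fan_def edgesN[symmetric] using fanN injN[folded edgesN] by (intro conjI)
  then have "card ?N \<le> k" by (rule no_rainbow)
  moreover have "{p, q} \<notin> ?M" using out[of p] pq(1) by blast
  moreover have "finite ?M" using M1 by (simp add: fan_def)
  ultimately show ?thesis using M1 by (simp add: D_def)
qed

text \<open>The centre \<open>y\<close> belongs to a twin pair \<open>S = {y, y'}\<close> in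
  \<open>B0\<close>. To the triangles over \<open>M\<close> come two more: one over
  \<open>Q\<close>, which has the colour of \<open>g1\<close>, and one with \<open>S\<close> as a
  spoke of the colour of \<open>g0\<close> and a clean vertex \<open>a\<close> of \<open>A\<close>.
  The two colours differ because \<open>g0 \<noteq> g1\<close>.\<close>

lemma inner_matching_less:
  assumes P: "twin_pairs c B0 P P' g0" "g0 \<in> E" and Q: "twin_pairs c A0 Q Q' g1" "g1 \<in> E"
    and neq: "g0 \<noteq> g1" and M: "matching (E - {g0, g1}) M" "\<Union>M \<subseteq> A"
  shows "card M + 2 \<le> k"
proof -
  interpret sw: coloured_bipartition c V B A B0 A0 E k by (rule swap)
  have P2: "P \<subseteq> B0" "P' \<subseteq> B0" "card P = 2" "card P' = 2" "P \<inter> P' = {}" "c P = c g0" "c P' = c g0"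
      "finite P" "finite P'"
    using P(1) by (auto simp: twin_pairs_def nsets_def)
  have Q2: "Q \<subseteq> A0" "card Q = 2" "c Q = c g1"
    using Q(1) by (auto simp: twin_pairs_def nsets_def)
  have "card ((g0 \<union> g1) \<inter> B0) \<le> card (g0 \<inter> B0) + card (g1 \<inter> B0)"
    by (simp add: Int_Un_distrib2 card_Un_le)
  then have "card ((g0 \<union> g1) \<inter> B0) \<le> 2"
    using edge_clean_card[OF P(2)] edge_clean_card[OF Q(2)] by linarith
  moreover have "card (P \<union> P') = 4" using P2 by (simp add: card_Un_disjoint)
  ultimately have "\<not> P \<union> P' \<subseteq> (g0 \<union> g1) \<inter> B0"
    using card_mono[of "(g0 \<union> g1) \<inter> B0" "P \<union> P'"] fin(4) by auto
  \<comment> \<open>Each of \<open>g0\<close> and \<open>g1\<close> has at most one end in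
    \<open>B0\<close>, so some of the four vertices of the twin pairs lies on neither; its edges to
    \<open>A\<close> all survive the deletion.\<close>
  then obtain y where y: "y \<in> P \<union> P'" "y \<notin> g0" "y \<notin> g1" using P2(1,2) by blast
  then obtain S where S: "y \<in> S" "S \<subseteq> B0" "card S = 2" "c S = c g0" using P2 by blast
  then obtain y' where y': "S = {y, y'}" "y \<noteq> y'" by (metis card_2_iff insertE insert_commute singletonD)
  obtain q q' where q: "Q = {q, q'}" "q \<noteq> q'" using Q2(2) by (auto simp: card_2_iff)
  have "card (Q \<union> g0 \<union> g1) \<le> card Q + card g0 + card g1"
    by (meson card_Un_le order_trans add_le_mono1)
  then have "card (Q \<union> g0 \<union> g1) \<le> 6"
    using Q2(2) edge_card(1)[OF P(2)] edge_card(1)[OF Q(2)] by simp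
  moreover have "finite (Q \<union> g0 \<union> g1)" using q(1) edge_card(2)[OF P(2)] edge_card(2)[OF Q(2)] by simp
  ultimately have "\<not> A0 \<subseteq> Q \<union> g0 \<union> g1"
    using card_mono[of "Q \<union> g0 \<union> g1" A0] sizeA by auto
  \<comment> \<open>As \<open>a\<close> is off \<open>g0\<close> and \<open>g1\<close>, the edge
    \<open>{y', a}\<close> survives too, although \<open>y'\<close> may lie on one of them.\<close>
  then obtain a where a: "a \<in> A0" "a \<notin> Q" "a \<notin> g0" "a \<notin> g1" by blast
  have yB: "y \<in> B0" "y \<in> B" "y' \<in> B0" "y' \<in> B" using S y' B0(1) by auto
  have aA: "a \<in> A" "q \<in> A0" "q' \<in> A0" "q \<in> A" "q' \<in> A" using a(1) Q2(1) q(1) A0(1) by auto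
  have MA0: "\<Union>M \<inter> A0 = {}"
  proof -
    have "e \<inter> A0 = {}" if "e \<in> M" for e
      using that M by (intro sw.clean_not_in_inner_edge) (auto simp: matching_def)
    then show ?thesis by blast
  qed
  have ME: "M \<subseteq> E - {g0, g1}" using M(1) by (auto simp: matching_def)
  have clean: "{b, a} \<in> E" if "b \<in> B0" "a \<in> A" for a b
    using B0(2)[OF that(1)] that(2) by (auto simp: nbrs_def)
  have spoke: "{y, u} \<in> E - {g0, g1}" if "u \<in> A" for u
    using clean[OF yB(1) that] y by auto
  have fanM: "fan y M"
    unfolding fan_def
  proof (intro conjI ballI)
    show "finite M" using ME fin(5) by (meson finite_Diff finite_subset)
    show "card e = 2" if "e \<in> M" for e using that ME edge_card(1) by blast
    show "pairwise disjnt M" using M(1) by (simp add: matching_def)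
    show "y \<notin> \<Union>M" using M(2) yB(2) AB(2) by blast
  qed
  let ?M1 = "insert {y', a} M"
  have y'A: "y' \<notin> A" "y \<notin> A" using yB AB(2) by auto
  have out1: "y' \<notin> \<Union>M" "a \<notin> \<Union>M" "q \<notin> \<Union>M" "q' \<notin> \<Union>M"
    using M(2) y'A MA0 a(1) aA by auto
  have fan1: "fan y ?M1"
    by (rule fan_insert[OF fanM]) (use out1 aA y'A y'(2) in auto)
  have out2: "q \<notin> \<Union>?M1" "q' \<notin> \<Union>?M1"
    using out1 aA y'A a(2) q(1) by auto
  let ?M2 = "insert {q, q'} ?M1"
  have fan2: "fan y ?M2"
    by (rule fan_insert[OF fan1]) (use out2 q(2) aA y'A in auto)
  define F where "F = {{y, q}, {y, q'}, {y', a}, {y, a}} \<union> fan_edges y M"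
  have edges: "fan_edges y ?M2 = insert {q, q'} (insert {y, y'} F)"
    unfolding fan_edges_insert F_def by (simp only: Un_insert_left Un_empty_left insert_commute)
  have F: "F \<subseteq> E - {g0, g1}"
  proof -
    have "{y', a} \<in> E - {g0, g1}" using clean[OF yB(3) aA(1)] a by auto
    moreover have "fan_edges y M \<subseteq> E - {g0, g1}"
      unfolding fan_edges_def using ME spoke M(2) by blast
    ultimately show ?thesis unfolding F_def using spoke aA by blast
  qed
  have inj1: "inj_on c (insert {y, y'} F)"
    using F S(4) y'(1) by (intro inj_on_insert_recoloured[OF inj P(2)]) auto
  have "c {q, q'} \<notin> c ` insert {y, y'} F"
  proof
    assume *: "c {q, q'} \<in> c ` insert {y, y'} F"
    have cq: "c {q, q'} = c g1" using Q2(3) q(1) by simp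
    have "c g1 \<noteq> c {y, y'}"
      using S(4) y'(1) inj P(2) Q(2) neq by (auto simp: inj_on_def)
    then obtain h where "h \<in> F" "c g1 = c h" using * cq by auto
    then show False using inj F Q(2) by (auto simp: inj_on_def)
  qed
  then have inj2: "inj_on c (insert {q, q'} (insert {y, y'} F))"
    using inj1 by (metis Diff_subset image_mono inj_on_insert subsetD)
  have "{q, q'} \<in> [V]\<^bsup>2\<^esup>" "{y, y'} \<in> [V]\<^bsup>2\<^esup>"
    using aA yB q(2) y'(2) AB(1) by auto
  then have "fan_edges y ?M2 \<subseteq> [V]\<^bsup>2\<^esup>" unfolding edges using F EV by blast
  then have "rainbow_fan c V y ?M2"
    unfolding rainbow_fan_def edges using fan2 inj2 by simp
  then have "card ?M2 \<le> k" by (rule no_rainbow)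
  moreover have "{y', a} \<notin> M" "{q, q'} \<notin> ?M1" using out1 out2 by auto
  moreover have "finite M" using fanM by (simp add: fan_def)
  ultimately show ?thesis by simp
qed

end

section \<open>Bounds on inner edges and the final count\<close>

lemma degree_outside:
  assumes "x \<notin> \<Union>E"
  shows "degree E x = 0"
proof -
  have "{e \<in> E. x \<in> e} = {}" using assms by blast
  then show ?thesis unfolding degree_def by (simp only: card.empty)
qed

context coloured_bipartition
begin

text \<open>All three come from \<open>degree_plus_matching_less\<close>: the first with the empty
  matching, the second with the part of a maximum matching inside the neighbourhood of
  \<open>x\<close>, the third with a clean centre off \<open>g0\<close> and \<open>g1\<close>, which
  is joined to all of \<open>B\<close>.\<close>

lemma inner_bounds:
  assumes P: "twin_pairs c B0 P P' g0" "g0 \<in> E" and g1: "g1 \<in> E"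
    and E1: "E1 = E - {g0, g1}"
  shows "x \<in> A \<Longrightarrow> degree {e \<in> E1. e \<subseteq> A} x < k"
    and "x \<in> A \<Longrightarrow> degree {e \<in> E1. e \<subseteq> A} x + matching_number {e \<in> E1. e \<subseteq> B} < k + card (B - nbrs E1 x)"
    and "matching {e \<in> E1. e \<subseteq> B} M \<Longrightarrow> card M < k"
proof -
  let ?HA = "{e \<in> E1. e \<subseteq> A}" and ?HB = "{e \<in> E1. e \<subseteq> B}"
  have E1V: "E1 \<subseteq> [V]\<^bsup>2\<^esup>" using EV by (auto simp: E1)
  have HAV: "?HA \<subseteq> [V]\<^bsup>2\<^esup>" using E1V by blast
  have star: "card (nbrs E1 x \<inter> A) + card M < k"
    if "x \<in> A" "matching E1 M" "\<Union>M \<subseteq> B \<inter> nbrs E1 x" for x M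
    by (rule degree_plus_matching_less[OF P g1 E1 that])
  have deg: "degree ?HA x = card (nbrs E1 x \<inter> A)" if "x \<in> A" for x
    using degree_eq_card_nbrs[OF HAV] nbrs_within[OF that] by metis
  show "degree ?HA x < k" if "x \<in> A" for x
    using star[OF that, of "{}"] deg[OF that] by simp
  show "degree ?HA x + matching_number ?HB < k + card (B - nbrs E1 x)" if x: "x \<in> A" for x
  proof -
    have finHB: "finite ?HB" using fin(5) by (simp add: E1)
    obtain M where M: "max_matching ?HB M" using max_matching_exists[OF finHB] ..
    then have mM: "matching ?HB M" "card M = matching_number ?HB" by (auto simp: max_matching_def)
    then have finM: "finite M" using finHB by (auto simp: matching_def intro: finite_subset)
    define M' where "M' = {e \<in> M. e \<subseteq> nbrs E1 x}"
    have "matching E1 M'"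
      using matching_mono[OF matching_subset[OF mM(1), of M'], of E1] by (auto simp: M'_def)
    moreover have "\<Union>M' \<subseteq> B \<inter> nbrs E1 x"
      using mM(1) by (auto simp: matching_def M'_def)
    ultimately have *: "card (nbrs E1 x \<inter> A) + card M' < k" by (rule star[OF x])
    \<comment> \<open>Each edge of \<open>M\<close> outside \<open>M'\<close> has an end in
      \<open>B\<close> not adjacent to \<open>x\<close>. These ends are distinct, so the missing
      pairs at \<open>x\<close> bound the loss.\<close>
    have "\<exists>u. u \<in> e \<and> u \<in> B - nbrs E1 x" if "e \<in> M - M'" for e
    proof -
      have "e \<subseteq> B" "\<not> e \<subseteq> nbrs E1 x" using that mM(1) by (auto simp: matching_def M'_def)
      then show ?thesis by blast
    qed
    then obtain h where h: "\<And>e. e \<in> M - M' \<Longrightarrow> h e \<in> e \<and> h e \<in> B - nbrs E1 x" by metis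
    have "inj_on h (M - M')"
      using h matching_unique[OF mM(1)] by (intro inj_onI) (metis DiffD1)
    then have "card (M - M') \<le> card (B - nbrs E1 x)"
      using h fin(2) by (intro card_inj_on_le[of h]) auto
    moreover have "card M = card M' + card (M - M')"
      using card_Int_Diff[OF finM, of M'] by (simp add: M'_def Int_absorb1)
    ultimately show ?thesis using * mM(2) deg[OF x] by linarith
  qed
  show "card M < k" if M: "matching ?HB M" for M
  proof -
    have "card (g0 \<union> g1) \<le> 4"
      using card_Un_le[of g0 g1] edge_card(1)[OF P(2)] edge_card(1)[OF g1] by simp
    moreover have "finite (g0 \<union> g1)" using edge_card(2)[OF P(2)] edge_card(2)[OF g1] by simp
    ultimately have "\<not> A0 \<subseteq> g0 \<union> g1"
      using card_mono[of "g0 \<union> g1" A0] sizeA by auto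
    then obtain x where x: "x \<in> A0" "x \<notin> g0" "x \<notin> g1" by blast
    have "B \<subseteq> nbrs E1 x"
      using A0(2)[OF x(1)] x(2,3) by (auto simp: nbrs_def E1)
    moreover have "\<Union>M \<subseteq> B" using M by (auto simp: matching_def)
    moreover have "matching E1 M" using matching_mono[OF M] by blast
    moreover have "x \<in> A" using x(1) A0(1) by blast
    ultimately show ?thesis using star[of x M] by fastforce
  qed
qed

text \<open>A matching of size \<open>k - 1\<close> inside \<open>A\<close> forces
  \<open>g0 = g1\<close>, by \<open>inner_matching_less\<close>. Then each vertex of
  \<open>B\<close> has at most as many inner edges as missing pairs, so the missing pairs outweigh
  the inner edges of \<open>B\<close>, and \<open>A\<close> has more than \<open>X\<close> inner
  edges, against \<open>extr\<close>. The conditional \<open>1\<close> reflects that a single edge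
  is deleted when \<open>g0 = g1\<close>.\<close>

lemma matching_number_not_full:
  assumes P: "twin_pairs c B0 P P' g0" "g0 \<in> E" and Q: "twin_pairs c A0 Q Q' g1" "g1 \<in> E"
    and E1: "E1 = E - {g0, g1}"
    and edges: "card A * card B + X + (if g0 = g1 then 1 else 0) \<le> card E1"
    and extr: "\<And>H. H \<subseteq> E \<Longrightarrow> \<Union>H \<subseteq> A \<Longrightarrow> (\<And>x. degree H x < k) \<Longrightarrow>
      (\<And>M. matching H M \<Longrightarrow> card M < k) \<Longrightarrow> card H \<le> X"
    and k: "k \<ge> 1"
  shows "matching_number {e \<in> E1. e \<subseteq> A} + 2 \<le> k"
proof (rule ccontr)
  assume contr: "\<not> ?thesis"
  let ?HA = "{e \<in> E1. e \<subseteq> A}" and ?HB = "{e \<in> E1. e \<subseteq> B}"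
  interpret sw: coloured_bipartition c V B A B0 A0 E k by (rule swap)
  have E1': "E1 = E - {g1, g0}" using E1 by (simp add: insert_commute)
  have E1V: "E1 \<subseteq> [V]\<^bsup>2\<^esup>" using EV by (auto simp: E1)
  have finHA: "finite ?HA" using fin(5) by (simp add: E1)
  have matA: "card M < k" if "matching ?HA M" for M
    by (rule sw.inner_bounds(3)[OF Q P(2) E1' that])
  obtain M where M: "matching ?HA M" "card M = matching_number ?HA"
    using max_matching_exists[OF finHA] by (auto simp: max_matching_def)
  then have full: "matching_number ?HA + 1 = k" using matA[OF M(1)] contr by linarith
  have "g0 = g1"
  proof (rule ccontr)
    assume "g0 \<noteq> g1"
    moreover have "matching (E - {g0, g1}) M" using matching_mono[OF M(1), of E1] E1 by blast
    moreover have "\<Union>M \<subseteq> A" using M(1) by (auto simp: matching_def)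
    ultimately have "card M + 2 \<le> k" using inner_matching_less[OF P Q] by blast
    then show False using contr M(2) by simp
  qed
  have "degree ?HB y \<le> card (A - nbrs E1 y)" if "y \<in> B" for y
    using sw.inner_bounds(2)[OF Q P(2) E1' that] full by linarith
  then have "(\<Sum>y\<in>B. degree ?HB y) \<le> card (missing B A E1)"
    using fin by (subst card_missing) (auto intro: sum_mono)
  moreover have "?HB \<subseteq> [B]\<^bsup>2\<^esup>" using E1V by (auto simp: nsets_def)
  ultimately have "2 * card ?HB \<le> card (missing A B E1)"
    using sum_degree[OF fin(2), of ?HB] by (simp add: card_missing_swap[of A B])
  moreover have "card E1 + card (missing A B E1) = card ?HA + card ?HB + card A * card B"
    by (rule card_edges_bipartition[OF finV E1V AB])
  ultimately have "X + 1 \<le> card ?HA" using edges \<open>g0 = g1\<close> by simp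
  moreover have "card ?HA \<le> X"
  proof (rule extr)
    show "degree ?HA x < k" for x
    proof (cases "x \<in> A")
      case True
      then show ?thesis by (rule inner_bounds(1)[OF P Q(2) E1])
    next
      case False
      then have "x \<notin> \<Union>?HA" by blast
      then show ?thesis using degree_outside k by (metis less_le_trans zero_less_one)
    qed
  qed (use E1 matA in auto)
  ultimately show False by simp
qed

text \<open>\<open>weighted_edge_bound\<close> is applied to \<open>A\<close> with
  \<open>\<mu> x = card (B - nbrs E1 x)\<close>. A larger matching number in \<open>B\<close> lowers
  \<open>D\<close> and hence the admissible degrees in \<open>A\<close>.\<close>

lemma inner_edges_le:
  assumes P: "twin_pairs c B0 P P' g0" "g0 \<in> E" and g1: "g1 \<in> E" and E1: "E1 = E - {g0, g1}"
    and b: "matching_number {e \<in> E1. e \<subseteq> B} + 2 \<le> k"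
  shows "2 * card {e \<in> E1. e \<subseteq> A} \<le> card (missing A B E1) +
    class_weight k (matching_number {e \<in> E1. e \<subseteq> B}) * matching_number {e \<in> E1. e \<subseteq> A}"
proof -
  let ?HA = "{e \<in> E1. e \<subseteq> A}" and ?b = "matching_number {e \<in> E1. e \<subseteq> B}"
  note D = inner_bounds(1,2)[OF P g1 E1]
  have "2 * card ?HA \<le> (\<Sum>x\<in>A. card (B - nbrs E1 x)) + class_weight k ?b * matching_number ?HA"
  proof (rule weighted_edge_bound[where p = "k - 1" and D = "k - 1 - ?b"])
    show "?HA \<subseteq> [A]\<^bsup>2\<^esup>" using EV by (auto simp: E1 nsets_def)
    show "degree ?HA x \<le> k - 1" if "x \<in> A" for x using D(1)[OF that] by linarith
    show "degree ?HA x \<le> k - 1 - ?b + card (B - nbrs E1 x)" if "x \<in> A" for x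
      using D(2)[OF that] b by linarith
  qed (use class_weight_ge[OF b] fin in auto)
  then show ?thesis using fin by (simp add: card_missing)
qed

text \<open>Adding the bounds of \<open>inner_edges_le\<close> for both sides, the inner edges
  exceed the missing pairs by less than \<open>(k - 1)\<^sup>2\<close>. So \<open>E1\<close> has
  fewer than \<open>card A * card B + X\<close> edges, a contradiction.\<close>

lemma too_many_colours:
  assumes k: "k \<ge> 2" and X: "(k - 1)\<^sup>2 \<le> X" and edges: "card A * card B + X + 2 \<le> card E"
    and extr: "\<And>H. H \<subseteq> E \<Longrightarrow> \<Union>H \<subseteq> A \<or> \<Union>H \<subseteq> B \<Longrightarrow> (\<And>x. degree H x < k) \<Longrightarrow>
      (\<And>M. matching H M \<Longrightarrow> card M < k) \<Longrightarrow> card H \<le> X"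
  shows False
proof -
  interpret sw: coloured_bipartition c V B A B0 A0 E k by (rule swap)
  obtain P P' g0 where P: "twin_pairs c B0 P P' g0" "g0 \<in> E" by (rule twin_pairs_exist)
  obtain Q Q' g1 where Q: "twin_pairs c A0 Q Q' g1" "g1 \<in> E" by (rule sw.twin_pairs_exist)
  define E1 where "E1 = E - {g0, g1}"
  have E1': "E1 = E - {g1, g0}" by (simp add: E1_def insert_commute)
  have E1V: "E1 \<subseteq> [V]\<^bsup>2\<^esup>" using EV by (auto simp: E1_def)
  let ?HA = "{e \<in> E1. e \<subseteq> A}" and ?HB = "{e \<in> E1. e \<subseteq> B}"
  have "card E1 = card E - card {g0, g1}"
    unfolding E1_def using P(2) Q(2) by (intro card_Diff_subset) auto
  then have c1: "card A * card B + X + (if g0 = g1 then 1 else 0) \<le> card E1"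
    using edges by auto
  then have c2: "card B * card A + X + (if g1 = g0 then 1 else 0) \<le> card E1"
    by (simp add: mult.commute eq_commute)
  have a: "matching_number ?HA + 2 \<le> k"
    by (rule matching_number_not_full[OF P Q E1_def c1]) (use extr k in auto)
  have b: "matching_number ?HB + 2 \<le> k"
    by (rule sw.matching_number_not_full[OF Q P E1' c2]) (use extr k in auto)
  have "2 * card ?HA \<le> card (missing A B E1) + class_weight k (matching_number ?HB) * matching_number ?HA"
    by (rule inner_edges_le[OF P Q(2) E1_def b])
  moreover have "2 * card ?HB \<le> card (missing A B E1) + class_weight k (matching_number ?HA) * matching_number ?HB"
    using sw.inner_edges_le[OF Q P(2) E1' a] by (simp add: card_missing_swap[of A B])
  moreover have "card E1 + card (missing A B E1) = card ?HA + card ?HB + card A * card B"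
    by (rule card_edges_bipartition[OF finV E1V AB])
  moreover have "class_weight k (matching_number ?HB) * matching_number ?HA
      + class_weight k (matching_number ?HA) * matching_number ?HB < 2 * (k - 1)\<^sup>2"
    by (rule class_weight_less[OF a b])
  ultimately show False using c1 X by linarith
qed

end

section \<open>The anti-Ramsey number\<close>

text \<open>A vertex of \<open>A\<close> that is not clean lies on an inner edge, which accounts for
  two vertices, or in a missing pair, which accounts for one.\<close>

lemma card_unclean_le:
  assumes V: "finite V" "E \<subseteq> [V]\<^bsup>2\<^esup>" and AB: "A \<subseteq> V" "B \<subseteq> V"
  shows "card A \<le> card {x \<in> A. B \<subseteq> nbrs E x \<and> nbrs E x \<inter> A = {}}
    + (2 * card {e \<in> E. e \<subseteq> A} + card (missing A B E))"
proof -
  let ?A0 = "{x \<in> A. B \<subseteq> nbrs E x \<and> nbrs E x \<inter> A = {}}" and ?EA = "{e \<in> E. e \<subseteq> A}"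
  have fin: "finite A" "finite B" "finite (missing A B E)" "finite (\<Union>?EA)"
    using V AB by (auto simp: missing_def intro: finite_subset)
  have "A \<subseteq> ?A0 \<union> (\<Union>?EA \<union> fst ` missing A B E)"
  proof
    fix x assume x: "x \<in> A"
    consider "B \<subseteq> nbrs E x" "nbrs E x \<inter> A = {}" | y where "y \<in> B - nbrs E x" | y where "y \<in> nbrs E x \<inter> A"
      by blast
    then show "x \<in> ?A0 \<union> (\<Union>?EA \<union> fst ` missing A B E)"
    proof cases
      case 2
      then have "(x, y) \<in> missing A B E" using x by (simp add: missing_def)
      then show ?thesis by force
    next
      case 3
      then have "{x, y} \<in> ?EA" using x by (simp add: nbrs_def)
      then show ?thesis by blast
    qed (use x in blast)
  qed
  then have "card A \<le> card (?A0 \<union> (\<Union>?EA \<union> fst ` missing A B E))"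
    using fin by (intro card_mono) auto
  also have "\<dots> \<le> card ?A0 + card (\<Union>?EA \<union> fst ` missing A B E)" by (rule card_Un_le)
  also have "card (\<Union>?EA \<union> fst ` missing A B E) \<le> card (\<Union>?EA) + card (fst ` missing A B E)"
    by (rule card_Un_le)
  also have "card (\<Union>?EA) \<le> 2 * card ?EA" using V(2) by (intro card_Union_edges_le[of _ V]) auto
  also have "card (fst ` missing A B E) \<le> card (missing A B E)" using fin(3) by (rule card_image_le)
  finally show ?thesis by simp
qed

text \<open>Removing a vertex lowers the edge number of the balanced complete bipartite graph by
  \<open>m div 2\<close>; this sets the degree threshold for deletions.\<close>

lemma square_div_4_pred: "m \<ge> 1 \<Longrightarrow> (m - 1)\<^sup>2 div 4 + m div 2 = (m :: nat)\<^sup>2 div 4"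
proof (cases "even m")
  case True
  assume "m \<ge> 1"
  with True obtain j where "m = 2 * Suc j" by (metis dvdE not_one_le_zero mult_0_right not0_implies_Suc)
  then show ?thesis by (simp add: power2_eq_square algebra_simps)
next
  case False
  then obtain j where "m = 2 * j + 1" by (rule oddE)
  then show ?thesis by (simp add: power2_eq_square algebra_simps)
qed

lemma mult_le_square_div_4: "a * b \<le> (a + b :: nat)\<^sup>2 div 4"
proof -
  have "int (4 * (a * b)) \<le> int ((a + b)\<^sup>2)"
    using zero_le_power2[of "int a - int b"] by (simp add: power2_eq_square algebra_simps)
  then have "4 * (a * b) \<le> (a + b)\<^sup>2" by (simp only: of_nat_le_iff)
  then show ?thesis by simp
qed

lemma rainbow_fan_exists:
  fixes c :: "nat set \<Rightarrow> 'c"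
  assumes k: "k \<ge> 2" and n: "n \<ge> 50 * (k + 1)\<^sup>2"
    and col: "card (c ` [{..<n}]\<^bsup>2\<^esup>) = turan_number n (friendship_graph k) + 2"
  shows "\<exists>x M. rainbow_fan c {..<n} x M \<and> card M = k + 1"
proof (rule ccontr)
  assume contr: "\<not> ?thesis"
  have no: "card M \<le> k" if M: "rainbow_fan c {..<n} x M" for x M
  proof (rule ccontr)
    assume "\<not> card M \<le> k"
    then have "k + 1 \<le> card M" by simp
    then obtain N where "N \<subseteq> M" "card N = k + 1" by (rule obtain_subset_with_card_n)
    then show False using contr rainbow_fan_subset[OF M] by blast
  qed
  have n': "50 * k\<^sup>2 + 100 * k + 50 \<le> n" using n by (simp add: power2_eq_square algebra_simps)
  define X where "X = turan_number n (friendship_graph k) - n\<^sup>2 div 4"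
  have lower: "n\<^sup>2 div 4 + (k - 1)\<^sup>2 \<le> turan_number n (friendship_graph k)"
    using k n' by (intro turan_number_ge_square) linarith+
  then have X: "(k - 1)\<^sup>2 \<le> X" "turan_number n (friendship_graph k) = n\<^sup>2 div 4 + X"
    by (auto simp: X_def)
  \<comment> \<open>The term \<open>n - card U\<close> demands one more surplus colour per deleted
    vertex, which keeps a smallest such set from being too small.\<close>
  define many where "many U \<longleftrightarrow> U \<subseteq> {..<n} \<and> (card U)\<^sup>2 div 4 + X + 2 + (n - card U) \<le> card (c ` [U]\<^bsup>2\<^esup>)" for U
  have "many {..<n}" using col X(2) by (simp add: many_def)
  then obtain V where V: "many V" "\<And>U. many U \<Longrightarrow> card V \<le> card U"
    using ex_has_least_nat[of many "{..<n}" card] by blast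
  define m where "m = card V"
  have Vn: "V \<subseteq> {..<n}" and Vcol: "m\<^sup>2 div 4 + X + 2 + (n - m) \<le> card (c ` [V]\<^bsup>2\<^esup>)"
    using V(1) by (auto simp: many_def m_def)
  have finV: "finite V" using Vn finite_subset by blast
  have mn: "m \<le> n" using card_mono[OF _ Vn] by (simp add: m_def)
  obtain E where E: "E \<subseteq> [V]\<^bsup>2\<^esup>" "inj_on c E" "c ` [V]\<^bsup>2\<^esup> = c ` E"
    using subset_image_inj[of "c ` [V]\<^bsup>2\<^esup>" c "[V]\<^bsup>2\<^esup>"] by blast
  have finE: "finite E" by (rule finite_edges[OF finV E(1)])
  have cE: "m\<^sup>2 div 4 + X + 2 + (n - m) \<le> card E"
    using Vcol E(3) card_image[OF E(2)] by simp
  have V2n: "[V]\<^bsup>2\<^esup> \<subseteq> [{..<n}]\<^bsup>2\<^esup>" using Vn by (rule nsets_mono)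
  have noV: "card M \<le> k" if "rainbow_fan c V x M" for x M
    using that V2n by (intro no) (auto simp: rainbow_fan_def)
  have mindeg: "m div 2 \<le> card (nbrs E x)" if x: "x \<in> V" for x
  proof -
    have m1: "m \<ge> 1" using x finV by (auto simp: m_def Suc_le_eq card_gt_0_iff)
    have cx: "card (V - {x}) = m - 1" using x finV by (simp add: m_def)
    then have "\<not> many (V - {x})" using V(2)[of "V - {x}"] m1 by (auto simp: m_def)
    \<comment> \<open>The strict inequality absorbs the additional \<open>1\<close> in
      \<open>n - (m - 1)\<close>, so \<open>x\<close> still has degree at least
      \<open>m div 2\<close>.\<close>
    then have "card (c ` [V - {x}]\<^bsup>2\<^esup>) < (m - 1)\<^sup>2 div 4 + X + 2 + (n - (m - 1))"
      using Vn cx by (auto simp: many_def)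
    moreover have "card {e \<in> E. x \<notin> e} \<le> card (c ` [V - {x}]\<^bsup>2\<^esup>)"
    proof -
      have "card {e \<in> E. x \<notin> e} = card (c ` {e \<in> E. x \<notin> e})"
        using E(2) by (intro card_image[symmetric]) (auto intro: inj_on_subset)
      also have "\<dots> \<le> card (c ` [V - {x}]\<^bsup>2\<^esup>)"
        using E(1) finV by (intro card_mono image_mono) (auto simp: nsets_def finite_imp_finite_nsets)
      finally show ?thesis .
    qed
    moreover have "card E = card {e \<in> E. x \<notin> e} + degree E x"
    proof -
      have "E = {e \<in> E. x \<notin> e} \<union> {e \<in> E. x \<in> e}" by blast
      then show ?thesis
        unfolding degree_def using finE by (subst card_Un_disjoint[symmetric]) auto
    qed
    ultimately have "m div 2 \<le> degree E x"
      using square_div_4_pred[OF m1] cE m1 mn by linarith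
    then show ?thesis by (simp add: degree_eq_card_nbrs[OF E(1)])
  qed
  have free: "fan_free (Suc k) E"
  proof (rule fan_freeI)
    fix x M assume M: "fan x M" "card M = Suc k" "fan_edges x M \<subseteq> E"
    then have "rainbow_fan c V x M"
      unfolding rainbow_fan_def using E inj_on_subset by blast
    then show False using noV M(2) by fastforce
  qed
  interpret dense_fan_free V E k m
    by unfold_locales (use finV E(1) free mindeg in \<open>auto simp: m_def\<close>)
  have m_big: "26 * k + 6 \<le> m"
  proof (rule ccontr)
    assume "\<not> 26 * k + 6 \<le> m"
    then have m: "m \<le> 26 * k + 5" by simp
    have "m\<^sup>2 \<le> 4 * (m\<^sup>2 div 4) + 3" by presburger
    moreover have "m * m \<le> m * (2 * (m div 2) + 1)" by (intro mult_le_mono2) presburger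
    moreover have "2 * card E + m * (m div 2) \<le> m * (m + 2 * k)" by (rule card_edges_le)
    \<comment> \<open>The surplus \<open>n - m\<close> meets the upper bound of
      \<open>card_edges_le\<close> here; for small \<open>m\<close> this contradicts the size of
      \<open>n\<close>.\<close>
    ultimately have "4 * n \<le> (4 * k + 5) * m"
      using cE mn by (simp add: power2_eq_square algebra_simps)
    also have "\<dots> \<le> (4 * k + 5) * (26 * k + 5)" using m by (rule mult_le_mono2)
    also have "\<dots> = 104 * k\<^sup>2 + 150 * k + 25" by (simp add: power2_eq_square algebra_simps)
    finally show False using n' by linarith
  qed
  obtain A B where AB: "A \<union> B = V" "A \<inter> B = {}"
    and deg: "\<And>x. x \<in> A \<Longrightarrow> card (nbrs E x \<inter> A) \<le> k" "\<And>x. x \<in> B \<Longrightarrow> card (nbrs E x \<inter> B) \<le> k"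
    and inner: "card {e \<in> E. e \<subseteq> A} + card {e \<in> E. e \<subseteq> B} \<le> (4 * k + 1) * k"
    and size: "m div 2 \<le> card A + 2 * k" "m div 2 \<le> card B + 2 * k"
    using bipartition[OF m_big] by blast
  have fin: "finite A" "finite B" using AB(1) finV by auto
  have "card A + card B = m"
    using AB fin by (metis card_Un_disjoint m_def)
  then have AB4: "card A * card B \<le> m\<^sup>2 div 4" using mult_le_square_div_4[of "card A" "card B"] by simp
  have "card E + card (missing A B E) = card {e \<in> E. e \<subseteq> A} + card {e \<in> E. e \<subseteq> B} + card A * card B"
    by (rule card_edges_bipartition[OF finV E(1) AB])
  moreover have k2: "(4 * k + 1) * k = 4 * k\<^sup>2 + k" by (simp add: power2_eq_square algebra_simps)
  \<comment> \<open>\<open>card A * card B\<close> is at most \<open>m\<^sup>2 div 4\<close>, so the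
    inner edges, at most \<open>4 * k\<^sup>2 + k\<close> in number, must make up for both missing
    pairs and deleted vertices.\<close>
  ultimately have miss: "card (missing A B E) + (n - m) \<le> 4 * k\<^sup>2 + k"
    using cE AB4 inner by linarith
  then have mm: "23 * k\<^sup>2 + 49 * k + 24 \<le> m div 2" using n' mn by linarith
  define A0 where "A0 = {x \<in> A. B \<subseteq> nbrs E x \<and> nbrs E x \<inter> A = {}}"
  define B0 where "B0 = {x \<in> B. A \<subseteq> nbrs E x \<and> nbrs E x \<inter> B = {}}"
  have "card A \<le> card A0 + (2 * card {e \<in> E. e \<subseteq> A} + card (missing A B E))"
    unfolding A0_def using AB by (intro card_unclean_le[OF finV E(1)]) auto
  \<comment> \<open>At most \<open>3 * (4 * k\<^sup>2 + k)\<close> vertices of \<open>A\<close> are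
    not clean, out of at least \<open>23 * k\<^sup>2 + 47 * k + 24\<close>.\<close>
  then have sizeA: "2 * k + 12 \<le> card A0" using mm miss size inner k2 by linarith
  have "card B \<le> card B0 + (2 * card {e \<in> E. e \<subseteq> B} + card (missing A B E))"
    unfolding B0_def card_missing_swap[of A B] using AB by (intro card_unclean_le[OF finV E(1)]) auto
  then have sizeB: "2 * k + 12 \<le> card B0" using mm miss size inner k2 by linarith
  interpret col: coloured_bipartition c V A B A0 B0 E k
    by unfold_locales
      (use finV E AB deg sizeA sizeB noV in \<open>auto simp: A0_def B0_def\<close>)
  show False
  proof (rule col.too_many_colours[OF k X(1)])
    show "card A * card B + X + 2 \<le> card E" using cE AB4 by linarith
    fix H assume H: "H \<subseteq> E" "\<Union>H \<subseteq> A \<or> \<Union>H \<subseteq> B" "\<And>x. degree H x < k"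
      "\<And>M. matching H M \<Longrightarrow> card M < k"
    have "H \<subseteq> {e \<in> E. e \<subseteq> A} \<or> H \<subseteq> {e \<in> E. e \<subseteq> B}" using H(1,2) by blast
    then have "card H \<le> card {e \<in> E. e \<subseteq> A} \<or> card H \<le> card {e \<in> E. e \<subseteq> B}"
      using finE card_mono[of "{e \<in> E. e \<subseteq> A}" H] card_mono[of "{e \<in> E. e \<subseteq> B}" H] by auto
    then have cH: "card H \<le> 4 * k\<^sup>2 + k" using inner k2 by linarith
    have HV: "H \<subseteq> [V]\<^bsup>2\<^esup>" using H(1) E(1) by blast
    \<comment> \<open>\<open>H\<close> has so few edges that its vertices fit into half of all
      \<open>n\<close> vertices. Since \<open>X\<close> is the surplus of the Turan number over
      \<open>n\<^sup>2 div 4\<close>, it bounds \<open>card H\<close>.\<close>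
    have "card (\<Union>H) \<le> n div 2" using card_Union_edges_le[OF HV] cH n' by linarith
    then have "n\<^sup>2 div 4 + card H \<le> turan_number n (friendship_graph k)"
      using HV V2n H(3,4) by (intro turan_number_ge_bipartite) auto
    then show "card H \<le> X" using X(2) by simp
  qed
qed

theorem theorem1p1:
  fixes n k :: nat
  assumes "k \<ge> 2" and "n \<ge> 50 * (k + 1)\<^sup>2"
  shows "anti_ramsey n {friendship_graph (k + 1)} = turan_number n (friendship_graph k) + 2"
proof -
  have edges: "edges (complete_graph n) = [{..<n}]\<^bsup>2\<^esup>" by (simp add: complete_graph_def)
  have iff: "(\<exists>G\<in>{friendship_graph (k + 1)}. \<exists>H. subgraph H (complete_graph n) \<and> graph_iso G H \<and> rainbow c H)
      \<longleftrightarrow> (\<exists>x M. rainbow_fan c {..<n} x M \<and> card M = k + 1)" for c :: "nat set \<Rightarrow> nat"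
    by (rule rainbow_friendship_graph_iff) simp
  have "50 * k\<^sup>2 + 100 * k + 50 \<le> n" using assms(2) by (simp add: power2_eq_square algebra_simps)
  then have n: "2 * k + 1 \<le> n" by linarith
  show ?thesis
    unfolding anti_ramsey_def iff edges
  \<comment> \<open>Smaller positive values \<open>r\<close> are refuted by a colouring with exactly
    \<open>r\<close> colours; the claimed value itself forces a rainbow fan.\<close>
  proof (rule Least_equality)
    fix r assume r: "1 \<le> r \<and> (\<forall>c :: nat set \<Rightarrow> nat. card (c ` [{..<n}]\<^bsup>2\<^esup>) = r \<longrightarrow>
      (\<exists>x M. rainbow_fan c {..<n} x M \<and> card M = k + 1))"
    show "turan_number n (friendship_graph k) + 2 \<le> r"
    proof (rule ccontr)
      assume "\<not> ?thesis"
      then have "r \<le> turan_number n (friendship_graph k) + 1" by simp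
      then show False
        using colouring_without_rainbow_fan[OF _ n, of r] r assms(1) by fastforce
    qed
  qed (use rainbow_fan_exists[OF assms] in auto)
qed

end
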